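(* Let $\ell$ be a positive integer and let $\mathbf{m}=(\mathbf{m}_S)_{S\in\binom{[\ell]}{2}}$ be a vector of non-negative integers, both fixed. Then, as $n\to\infty$, $$s^*(n,\ell,\mathbf{m})=\left(1+O\left(\frac{1}{\sqrt n}\right)\right)\cdot 2^n\cdot\prod_{S\in\binom{[\ell]}{2}}\left(\frac{1}{\mathbf{m}_S!}\left(\frac{\mathbf{m}_S\cdot n}{\sum_{S'\in\binom{[\ell]}{2}}\mathbf{m}_{S'}}\right)^{\mathbf{m}_S}\right),$$ where the constant implicit in $O(\cdot)$ may depend on $\ell$ and $\mathbf{m}$ only.
   Context: $[n]=\{1,\dots,n\}$, $2^{[n]}$ is the set of all subsets of $[n]$, and $\binom{X}{k}$ is the family of $k$-element subsets of $X$. The vector $\mathbf{m}$ is indexed by unordered pairs $\{k,k'\}\in\binom{[\ell]}{2}$, and one writes $\mathbf{m}_{k,k'}=\mathbf{m}_{k',k}=\mathbf{m}_{\{k,k'\}}$. Families $\mathcal{F}_1,\dots,\mathcal{F}_\ell\subset 2^{[n]}$ satisfy the $\mathbf{m}$-overlapping property if for any distinct $k_1,k_2\in[\ell]$ and any $F_1\in\mathcal{F}_{k_1}$, $F_2\in\mathcal{F}_{k_2}$ one has $|F_1\cap F_2|\le\mathbf{m}_{k_1,k_2}$. The number $s^*(n,\ell,\mathbf{m})$ is the maximum of $|\mathcal{F}_1|\cdots|\mathcal{F}_\ell|$ over all families $\mathcal{F}_1,\dots,\mathcal{F}_\ell\subset 2^{[n]}$ with the $\mathbf{m}$-overlapping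 property. Convention: a factor of the product over $S$ with $\mathbf{m}_S=0$ equals $1$, and an empty product equals $1$. *)

theory Defs
  imports Complex_Main "HOL-Library.FuncSet" "HOL-Library.Ramsey" "HOL-Library.Landau_Symbols"
begin

text \<open>
  Families of sets are indexed by \<open>{1..l}\<close>. The vector \<open>m\<close> is a function on sets of
  indices, of which only the values at two-element subsets of \<open>{1..l}\<close> are ever used; hence
  \<open>m {k, k'} = m {k', k}\<close> holds automatically.
\<close>

definition overlapping :: "nat \<Rightarrow> (nat set \<Rightarrow> nat) \<Rightarrow> (nat \<Rightarrow> nat set set) \<Rightarrow> bool" where
  "overlapping l m F \<longleftrightarrow>
     (\<forall>k1\<in>{1..l}. \<forall>k2\<in>{1..l}. k1 \<noteq> k2 \<longrightarrow>
        (\<forall>A\<in>F k1. \<forall>B\<in>F k2. card (A \<inter> B) \<le> m {k1, k2}))"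

definition overlapping_tuples :: "nat \<Rightarrow> nat \<Rightarrow> (nat set \<Rightarrow> nat) \<Rightarrow> (nat \<Rightarrow> nat set set) set" where
  "overlapping_tuples n l m = {F \<in> {1..l} \<rightarrow>\<^sub>E Pow (Pow {1..n}). overlapping l m F}"

definition s_star :: "nat \<Rightarrow> nat \<Rightarrow> (nat set \<Rightarrow> nat) \<Rightarrow> nat" where
  "s_star n l m = Max ((\<lambda>F. \<Prod>k\<in>{1..l}. card (F k)) ` overlapping_tuples n l m)"

text \<open>The maximum is taken over a finite nonempty set, so it is a genuine one.\<close>

lemma finite_overlapping_tuples: "finite (overlapping_tuples n l m)"
  unfolding overlapping_tuples_def
  by (rule finite_subset[where B = "{1..l} \<rightarrow>\<^sub>E Pow (Pow {1..n})"]) (auto intro!: finite_PiE)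

lemma overlapping_tuples_nonempty: "overlapping_tuples n l m \<noteq> {}"
proof -
  have "restrict (\<lambda>_. {}) {1..l} \<in> overlapping_tuples n l m"
    by (auto simp: overlapping_tuples_def overlapping_def)
  then show ?thesis by blast
qed

end

theory Submission
  imports Defs "HOL-Analysis.Infinite_Products"
begin

text \<open>
  Lower bound: split \<open>[n]\<close> into blocks \<open>Y S\<close>, one per pair \<open>S = {i, j}\<close>, of size about
  \<open>m S * n / M\<close>, where \<open>M\<close> is the sum of all \<open>m S\<close>. On \<open>Y S\<close> let one of the two families be
  free, let the other one use exactly \<open>m S\<close> elements, and let all other families avoid \<open>Y S\<close>.

  Upper bound: take a maximal tuple of families; they may be assumed to be downsets. Let \<open>p k y\<close> be
  the proportion of members of the \<open>k\<close>-th family containing \<open>y\<close>. Passing to links at \<open>y\<close> in a set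
  \<open>K\<close> of families lowers \<open>m S\<close> by one for every pair \<open>S \<subseteq> K\<close>, so that the product of \<open>p k y\<close>
  over \<open>K\<close> is bounded by a ratio of two values of \<open>s_star\<close>. For pairs this gives a recursion in
  \<open>n\<close>, hence the order of magnitude \<open>2 ^ n * n ^ M\<close>, and then \<open>p i y * p j y = O(1/n)\<close>; for
  triples it gives \<open>O(1/n^3)\<close>. It follows that every \<open>y\<close> has one family \<open>home y\<close> with
  \<open>p = 1/2 - O(1/n)\<close> and that all but one of the other families have \<open>p = O(n powr (-3/2))\<close>, so
  members containing \<open>y\<close> can be discarded from the latter at a total relative cost of
  \<open>O(1 / sqrt n)\<close>. In all but a fraction \<open>O(1/n)\<close> of the remaining tuples of members, each member
  can be enlarged by the elements of the other members that have their home in its family. For such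
  tuples the overlap condition bounds the number of non-home elements on each block by \<open>m S\<close>.
  Counting them and applying the AM-GM inequality yields the leading term.
\<close>

section \<open>Overlapping tuples and their links\<close>

text \<open>The ground set is a parameter and values outside \<open>{1..l}\<close> are free, so that
  deletions, links and unions over disjoint ground sets are plain functions of the index.\<close>

definition overlapping_on :: "nat set \<Rightarrow> nat \<Rightarrow> (nat set \<Rightarrow> nat) \<Rightarrow> (nat \<Rightarrow> nat set set) \<Rightarrow> bool" where
  "overlapping_on V l m F \<longleftrightarrow> (\<forall>k\<in>{1..l}. F k \<subseteq> Pow V) \<and> overlapping l m F"

lemma overlapping_onD:
  assumes "overlapping_on V l m F" "i \<in> {1..l}" "j \<in> {1..l}" "i \<noteq> j" "A \<in> F i" "B \<in> F j"
  shows "card (A \<inter> B) \<le> m {i, j}"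
  using assms by (auto simp: overlapping_on_def overlapping_def)

lemma overlapping_on_subset:
  assumes "overlapping_on V l m F" "k \<in> {1..l}" "A \<in> F k"
  shows "A \<subseteq> V"
  using assms unfolding overlapping_on_def by blast

lemma overlapping_on_finite:
  assumes "overlapping_on V l m F" "finite V" "k \<in> {1..l}"
  shows "finite (F k)"
proof (rule finite_subset)
  show "F k \<subseteq> Pow V" using overlapping_on_subset[OF assms(1,3)] by blast
qed (simp add: assms(2))

lemma overlapping_on_finite_mem:
  assumes "overlapping_on V l m F" "finite V" "k \<in> {1..l}" "A \<in> F k"
  shows "finite A"
  using overlapping_on_subset[OF assms(1,3,4)] assms(2) by (rule finite_subset)

section \<open>Maximality of \<open>s_star\<close>\<close>

lemma prod_card_le_s_star:
  assumes "overlapping_on {1..n} l m F"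
  shows "(\<Prod>k\<in>{1..l}. card (F k)) \<le> s_star n l m"
proof -
  have "restrict F {1..l} \<in> overlapping_tuples n l m"
    using assms unfolding overlapping_tuples_def overlapping_on_def overlapping_def
    by (simp add: restrict_PiE_iff)
  then have "(\<Prod>k\<in>{1..l}. card (restrict F {1..l} k)) \<le> s_star n l m"
    unfolding s_star_def by (intro Max_ge finite_imageI finite_overlapping_tuples imageI)
  then show ?thesis by simp
qed

lemma s_star_pos: "s_star n l m > 0"
proof -
  have "(\<Prod>k\<in>{1..l}. card ((\<lambda>_. {{}}) k :: nat set set)) \<le> s_star n l m"
    by (rule prod_card_le_s_star) (auto simp: overlapping_on_def overlapping_def)
  then show ?thesis by simp
qed

text \<open>Passing to all subsets of members only shrinks intersections, so the overlap bounds
  survive, and no family gets smaller. Hence the downward closure of a maximal tuple is again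
  maximal.\<close>

lemma s_star_attained_by_downsets:
  obtains F where "overlapping_on {1..n} l m F" "(\<Prod>k\<in>{1..l}. card (F k)) = s_star n l m"
    "\<And>k A B. k \<in> {1..l} \<Longrightarrow> A \<in> F k \<Longrightarrow> B \<subseteq> A \<Longrightarrow> B \<in> F k"
proof -
  have "s_star n l m \<in> (\<lambda>F. \<Prod>k\<in>{1..l}. card (F k)) ` overlapping_tuples n l m"
    unfolding s_star_def
    by (rule Max_in) (auto simp: finite_overlapping_tuples overlapping_tuples_nonempty)
  then obtain F where F: "F \<in> overlapping_tuples n l m" "s_star n l m = (\<Prod>k\<in>{1..l}. card (F k))"
    by auto
  define D where "D = (\<lambda>k. {B. \<exists>A\<in>F k. B \<subseteq> A})"
  have sub: "F k \<subseteq> Pow {1..n}" if "k \<in> {1..l}" for k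
    using F(1) that by (auto simp: overlapping_tuples_def PiE_def Pi_def)
  have D: "overlapping_on {1..n} l m D"
    unfolding overlapping_on_def overlapping_def
  proof (intro conjI ballI impI)
    fix k assume "k \<in> {1..l}"
    then show "D k \<subseteq> Pow {1..n}" using sub by (auto simp: D_def)
  next
    fix i j A B assume *: "i \<in> {1..l}" "j \<in> {1..l}" "i \<noteq> j" "A \<in> D i" "B \<in> D j"
    then obtain A' B' where AB: "A' \<in> F i" "A \<subseteq> A'" "B' \<in> F j" "B \<subseteq> B'" by (auto simp: D_def)
    have "A' \<subseteq> {1..n}" using sub * AB by auto
    then have "card (A \<inter> B) \<le> card (A' \<inter> B')"
      using AB by (intro card_mono) (auto intro: finite_subset)
    also have "\<dots> \<le> m {i, j}"
      using F(1) * AB by (auto simp: overlapping_tuples_def overlapping_def)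
    finally show "card (A \<inter> B) \<le> m {i, j}" .
  qed
  have "(\<Prod>k\<in>{1..l}. card (F k)) \<le> (\<Prod>k\<in>{1..l}. card (D k))"
  proof (intro prod_mono conjI)
    fix k assume "k \<in> {1..l}"
    then show "card (F k) \<le> card (D k)"
      using overlapping_on_finite[OF D] by (intro card_mono) (auto simp: D_def)
  qed simp
  with prod_card_le_s_star[OF D] F(2) have "(\<Prod>k\<in>{1..l}. card (D k)) = s_star n l m" by simp
  from that[OF D this] show thesis by (auto simp: D_def)
qed

text \<open>A point that no family uses may be added freely to the members of a single family, as it
  then enters no intersection. This doubles that family.\<close>

lemma prod_card_avoiding_le_s_star:
  assumes "overlapping_on ({1..n} - {y}) l m F" "y \<in> {1..n}" "l > 0"
  shows "2 * (\<Prod>k\<in>{1..l}. card (F k)) \<le> s_star n l m"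
proof -
  define G where "G = F(1 := F 1 \<union> insert y ` F 1)"
  have y: "y \<notin> A" if "A \<in> F k" "k \<in> {1..l}" for A k
    using overlapping_on_subset[OF assms(1) that(2,1)] by blast
  have "overlapping_on {1..n} l m G"
    unfolding overlapping_on_def overlapping_def
  proof (intro conjI ballI impI)
    fix k assume "k \<in> {1..l}"
    then have "F k \<subseteq> Pow {1..n}" using overlapping_on_subset[OF assms(1)] by blast
    then show "G k \<subseteq> Pow {1..n}" using assms(2) by (auto simp del: atLeastAtMost_iff simp: G_def)
  next
    fix i j A B assume ij: "i \<in> {1..l}" "j \<in> {1..l}" "i \<noteq> j" and AB: "A \<in> G i" "B \<in> G j"
    \<comment> \<open>Only family 1 has sets containing \<open>y\<close>, so deleting
      \<open>y\<close> leads back to \<open>F\<close> without changing intersections of members of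
      different families.\<close>
    have rem: "C - {y} \<in> F k" if "C \<in> G k" "k \<in> {1..l}" for C k
      using that y[OF _ that(2)] by (cases "k = 1") (auto simp: G_def)
    have "A - {y} \<in> F i" "B - {y} \<in> F j" using rem AB ij by auto
    moreover have "y \<notin> A \<inter> B"
      using AB y[OF _ ij(1)] y[OF _ ij(2)] ij(3) by (auto simp: G_def split: if_splits)
    then have "A \<inter> B = (A - {y}) \<inter> (B - {y})" by auto
    ultimately show "card (A \<inter> B) \<le> m {i, j}" using overlapping_onD[OF assms(1) ij] by simp
  qed
  then have "(\<Prod>k\<in>{1..l}. card (G k)) \<le> s_star n l m" by (rule prod_card_le_s_star)
  moreover have "card (G 1) = 2 * card (F 1)"
  proof -
    have fin: "finite (F 1)" using overlapping_on_finite[OF assms(1), of 1] assms(3) by simp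
    have "inj_on (insert y) (F 1)"
      using y[of _ 1] assms(3) by (intro inj_onI) (simp add: insert_ident)
    then have "card (insert y ` F 1) = card (F 1)" by (rule card_image)
    moreover have "F 1 \<inter> insert y ` F 1 = {}" using y[of _ 1] assms(3) by auto
    ultimately show ?thesis using fin by (simp add: G_def card_Un_disjoint)
  qed
  moreover have "(\<Prod>k\<in>{1..l}. card (G k)) = card (G 1) * (\<Prod>k\<in>{1..l}-{1}. card (F k))"
    using assms(3) by (subst prod.remove[of _ 1]) (auto simp: G_def intro!: arg_cong2[of _ _ _ _ "(*)"] prod.cong)
  moreover have "(\<Prod>k\<in>{1..l}. card (F k)) = card (F 1) * (\<Prod>k\<in>{1..l}-{1}. card (F k))"
    using assms(3) by (subst prod.remove[of _ 1]) auto
  ultimately show ?thesis by simp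
qed

text \<open>Linking the families in \<open>K\<close> at a point costs one unit on each pair inside
  \<open>K\<close>. Truncation at 0 does no harm: two linked members come from sets sharing the
  point, which forces \<open>m S > 0\<close>.\<close>

definition lower_on :: "nat set \<Rightarrow> (nat set \<Rightarrow> nat) \<Rightarrow> nat set \<Rightarrow> nat" where
  "lower_on K m S = (if S \<subseteq> K then m S - 1 else m S)"

definition link :: "nat \<Rightarrow> nat set set \<Rightarrow> nat set set" where
  "link y \<A> = (\<lambda>A. A - {y}) ` {A \<in> \<A>. y \<in> A}"

lemma card_link: "card (link y \<A>) = card {A \<in> \<A>. y \<in> A}"
  unfolding link_def by (intro card_image inj_onI) blast

text \<open>Two linked members come from members sharing \<open>y\<close>, so their intersection
  loses this point; if at most one of them is linked, the intersection cannot grow.\<close>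

lemma overlapping_on_link:
  assumes "overlapping_on {1..n} l m F"
  shows "overlapping_on {1..n} l (lower_on K m) (\<lambda>k. if k \<in> K then link y (F k) else F k)"
  unfolding overlapping_on_def overlapping_def
proof (intro conjI ballI impI)
  fix k assume "k \<in> {1..l}"
  then have "F k \<subseteq> Pow {1..n}" using overlapping_on_subset[OF assms] by blast
  then show "(if k \<in> K then link y (F k) else F k) \<subseteq> Pow {1..n}" unfolding link_def by auto
next
  fix i j A B
  assume ij: "i \<in> {1..l}" "j \<in> {1..l}" "i \<noteq> j"
    and AB: "A \<in> (if i \<in> K then link y (F i) else F i)" "B \<in> (if j \<in> K then link y (F j) else F j)"
  from AB obtain A' where A': "A' \<in> F i" "A = (if i \<in> K then A' - {y} else A')" "i \<in> K \<Longrightarrow> y \<in> A'"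
    by (cases "i \<in> K") (auto simp: link_def)
  from AB obtain B' where B': "B' \<in> F j" "B = (if j \<in> K then B' - {y} else B')" "j \<in> K \<Longrightarrow> y \<in> B'"
    by (cases "j \<in> K") (auto simp: link_def)
  have fin: "finite A'" using overlapping_on_finite_mem[OF assms _ ij(1) A'(1)] by simp
  have le: "card (A' \<inter> B') \<le> m {i, j}" by (rule overlapping_onD[OF assms ij A'(1) B'(1)])
  show "card (A \<inter> B) \<le> lower_on K m {i, j}"
  proof (cases "i \<in> K \<and> j \<in> K")
    case True
    then have "A \<inter> B = A' \<inter> B' - {y}" "y \<in> A' \<inter> B'" using A' B' by auto
    then show ?thesis using le fin True by (simp add: lower_on_def)
  next
    case False
    have "card (A \<inter> B) \<le> card (A' \<inter> B')"
      using A' B' fin by (intro card_mono) (auto split: if_splits)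
    then show ?thesis using le False by (auto simp: lower_on_def)
  qed
qed

section \<open>Densities of points in families\<close>

definition density :: "nat set set \<Rightarrow> nat \<Rightarrow> real" where
  "density \<A> y = card {A \<in> \<A>. y \<in> A} / card \<A>"

lemma density_nonneg: "density \<A> y \<ge> 0"
  by (simp add: density_def)

lemma card_link_density:
  assumes "finite \<A>" "\<A> \<noteq> {}"
  shows "real (card (link y \<A>)) = density \<A> y * card \<A>"
  using assms by (simp add: card_link density_def)

lemma card_avoiding_density:
  assumes "finite \<A>" "\<A> \<noteq> {}"
  shows "real (card {A \<in> \<A>. y \<notin> A}) = (1 - density \<A> y) * card \<A>"
proof -
  have "card \<A> = card {A \<in> \<A>. y \<in> A} + card {A \<in> \<A>. y \<notin> A}"
    using assms by (subst card_Un_disjoint[symmetric]) (auto intro: arg_cong[of _ _ card])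
  moreover have "density \<A> y * card \<A> = card {A \<in> \<A>. y \<in> A}"
    using assms by (simp add: density_def)
  ultimately show ?thesis by (simp add: left_diff_distrib)
qed

text \<open>In a downset, removing \<open>y\<close> injects the members containing \<open>y\<close>
  into those avoiding it. The avoiding members outside the image are exactly those that
  \<open>y\<close> cannot enlarge, and their number is nonnegative.\<close>

lemma card_insert_mem_density:
  assumes "finite \<A>" "\<A> \<noteq> {}" "\<And>A B. A \<in> \<A> \<Longrightarrow> B \<subseteq> A \<Longrightarrow> B \<in> \<A>"
  shows "real (card {A \<in> \<A>. insert y A \<notin> \<A>}) = (1 - 2 * density \<A> y) * card \<A>"
    and "density \<A> y \<le> 1/2"
proof -
  have "link y \<A> \<subseteq> {A \<in> \<A>. y \<notin> A}" using assms(3) unfolding link_def by blast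
  moreover have "{A \<in> \<A>. insert y A \<notin> \<A>} = {A \<in> \<A>. y \<notin> A} - link y \<A>"
  proof (intro set_eqI iffI)
    fix A assume "A \<in> {A \<in> \<A>. insert y A \<notin> \<A>}"
    then show "A \<in> {A \<in> \<A>. y \<notin> A} - link y \<A>"
      by (auto simp: link_def insert_absorb insert_Diff)
  next
    fix A assume A: "A \<in> {A \<in> \<A>. y \<notin> A} - link y \<A>"
    have "A \<in> link y \<A>" if "insert y A \<in> \<A>"
      unfolding link_def using A that by (intro image_eqI[of _ _ "insert y A"]) auto
    then show "A \<in> {A \<in> \<A>. insert y A \<notin> \<A>}" using A by blast
  qed
  ultimately have *: "card {A \<in> \<A>. insert y A \<notin> \<A>} + card (link y \<A>) = card {A \<in> \<A>. y \<notin> A}"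
    using card_Diff_subset[of "link y \<A>" "{A \<in> \<A>. y \<notin> A}"]
      card_mono[of "{A \<in> \<A>. y \<notin> A}" "link y \<A>"] assms(1)
      finite_subset[of "link y \<A>" "{A \<in> \<A>. y \<notin> A}"]
    by simp
  from arg_cong[OF this, of real] show 1: "real (card {A \<in> \<A>. insert y A \<notin> \<A>}) = (1 - 2 * density \<A> y) * card \<A>"
    using card_link_density[OF assms(1,2), of y] card_avoiding_density[OF assms(1,2), of y] by (simp add: algebra_simps)
  have "card \<A> > 0" using assms(1,2) by (simp add: card_gt_0_iff)
  moreover have "(1 - 2 * density \<A> y) * card \<A> \<ge> 0" unfolding 1[symmetric] by simp
  ultimately show "density \<A> y \<le> 1/2" by (simp add: zero_le_mult_iff)
qed

lemma maximal_downsets_nonempty: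
  assumes "(\<Prod>k\<in>{1..l}. card (F k)) = s_star n l m" "k \<in> {1..l}"
  shows "F k \<noteq> {}"
proof
  assume "F k = {}"
  then have "(\<Prod>k\<in>{1..l}. card (F k)) = 0" using assms(2) by (intro prod_zero bexI[of _ k]) auto
  then show False using assms(1) s_star_pos[of n l m] by linarith
qed

text \<open>Replacing the families in \<open>K\<close> by their links at \<open>y\<close> scales
  each of their sizes by its density and yields a tuple admissible for the lowered bounds.\<close>

lemma prod_density_le:
  assumes F: "overlapping_on {1..n} l m F" "(\<Prod>k\<in>{1..l}. card (F k)) = s_star n l m"
    and "K \<subseteq> {1..l}"
  shows "(\<Prod>k\<in>K. density (F k) y) * s_star n l m \<le> s_star n l (lower_on K m)"
proof -
  let ?G = "\<lambda>k. if k \<in> K then link y (F k) else F k"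
  have "real (\<Prod>k\<in>{1..l}. card (?G k)) = (\<Prod>k\<in>{1..l}. (if k \<in> K then density (F k) y else 1) * card (F k))"
    unfolding of_nat_prod
    using card_link_density[OF overlapping_on_finite[OF F(1)] maximal_downsets_nonempty[OF F(2)]]
    by (intro prod.cong) auto
  also have "\<dots> = (\<Prod>k\<in>{1..l}. if k \<in> K then density (F k) y else 1) * real (\<Prod>k\<in>{1..l}. card (F k))"
    by (simp add: prod.distrib)
  also have "(\<Prod>k\<in>{1..l}. if k \<in> K then density (F k) y else 1) = (\<Prod>k\<in>K. density (F k) y)"
    using assms(3) by (subst prod.inter_restrict[symmetric]) (auto intro!: prod.cong)
  finally show ?thesis
    using prod_card_le_s_star[OF overlapping_on_link[OF F(1), of K y]]
    by (simp only: F(2))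
qed

text \<open>This complements \<open>prod_density_le\<close> where there is nothing to lower:
  positive densities would give members of both families of \<open>S\<close> through
  \<open>y\<close>, overlapping at least in \<open>y\<close>.\<close>

lemma prod_density_eq_0:
  assumes F: "overlapping_on {1..n} l m F"
    and "K \<subseteq> {1..l}" "S \<in> [K]\<^bsup>2\<^esup>" "m S = 0"
  shows "(\<Prod>k\<in>K. density (F k) y) = 0"
proof (rule ccontr)
  have fK: "finite K" using assms(2) finite_subset by blast
  assume "\<not> ?thesis"
  then have nz: "density (F k) y \<noteq> 0" if "k \<in> K" for k using that fK by auto
  have ex: "\<exists>A\<in>F k. y \<in> A" if "k \<in> K" for k
    using nz[OF that] by (fastforce simp: density_def card_eq_0_iff)
  obtain i j where ij: "S = {i, j}" "i \<in> K" "j \<in> K" "i \<noteq> j" using assms(3) by (auto elim: nsets2_E)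
  obtain A B where AB: "A \<in> F i" "y \<in> A" "B \<in> F j" "y \<in> B"
    using ex[OF ij(2)] ex[OF ij(3)] by blast
  have "card (A \<inter> B) \<le> m {i, j}" using overlapping_onD[OF F _ _ ij(4) AB(1,3)] ij assms(2) by blast
  moreover have "finite A" using overlapping_on_finite_mem[OF F _ _ AB(1)] ij assms(2) by auto
  ultimately show False using AB assms(4) ij by auto
qed

lemma overlapping_on_avoiding:
  assumes "overlapping_on V l m F"
  shows "overlapping_on (V - {y}) l m (\<lambda>k. {A \<in> F k. y \<notin> A})"
  unfolding overlapping_on_def overlapping_def
proof (intro conjI ballI impI)
  fix k assume "k \<in> {1..l}"
  then show "{A \<in> F k. y \<notin> A} \<subseteq> Pow (V - {y})" using overlapping_on_subset[OF assms] by blast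
next
  fix i j A B
  assume "i \<in> {1..l}" "j \<in> {1..l}" "i \<noteq> j" "A \<in> {A \<in> F i. y \<notin> A}" "B \<in> {A \<in> F j. y \<notin> A}"
  then show "card (A \<inter> B) \<le> m {i, j}" using overlapping_onD[OF assms] by blast
qed

lemma prod_codensity_eq:
  assumes F: "overlapping_on {1..n} l m F" "(\<Prod>k\<in>{1..l}. card (F k)) = s_star n l m"
  shows "(\<Prod>k\<in>{1..l}. 1 - density (F k) y) * s_star n l m = real (\<Prod>k\<in>{1..l}. card {A \<in> F k. y \<notin> A})"
proof -
  have "real (\<Prod>k\<in>{1..l}. card {A \<in> F k. y \<notin> A}) = (\<Prod>k\<in>{1..l}. (1 - density (F k) y) * card (F k))"
    unfolding of_nat_prod
    using card_avoiding_density[OF overlapping_on_finite[OF F(1)] maximal_downsets_nonempty[OF F(2)]]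
    by (intro prod.cong) auto
  also have "\<dots> = (\<Prod>k\<in>{1..l}. 1 - density (F k) y) * s_star n l m"
    by (simp add: prod.distrib F(2)[symmetric])
  finally show ?thesis by simp
qed

text \<open>By the pair bound, one density of at least \<open>1 / (2 * real l)\<close> forces every
  other to be at most \<open>2 * real l * e\<close>. By the Weierstrass inequality the other factors
  multiply to at least \<open>1 - 2 * real l ^ 2 * e\<close>, so the product is almost as large as
  \<open>1 - p k\<close>.\<close>

lemma dominant_density:
  fixes p :: "nat \<Rightarrow> real"
  assumes "\<And>k. k \<in> {1..l} \<Longrightarrow> 0 \<le> p k" "\<And>k. k \<in> {1..l} \<Longrightarrow> p k \<le> 1/2"
    and "\<And>i j. i \<in> {1..l} \<Longrightarrow> j \<in> {1..l} \<Longrightarrow> i \<noteq> j \<Longrightarrow> p i * p j \<le> e"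
    and "k \<in> {1..l}" "p k \<ge> 1 / (2 * real l)" "e \<ge> 0"
  shows "1 - p k \<le> (\<Prod>j\<in>{1..l}. 1 - p j) + 2 * real l ^ 2 * e"
proof -
  have l: "l > 0" using assms(4) by auto
  have small: "\<forall>j\<in>{1..l} - {k}. p j \<le> 2 * real l * e"
  proof
    fix j assume j: "j \<in> {1..l} - {k}"
    have "p j * (1 / (2 * real l)) \<le> p j * p k"
      using assms(1)[of j] assms(5) j by (intro mult_left_mono) auto
    also have "\<dots> \<le> e" using assms(3)[of j k] assms(4) j by simp
    finally show "p j \<le> 2 * real l * e" using l by (simp add: field_simps)
  qed
  have "(\<Sum>j\<in>{1..l}-{k}. p j) \<le> (\<Sum>j\<in>{1..l}-{k}. 2 * real l * e)" using small by (intro sum_mono) auto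
  also have "\<dots> \<le> l * (2 * real l * e)" using assms(4,6) by (simp add: mult_right_mono)
  finally have sm: "(\<Sum>j\<in>{1..l}-{k}. p j) \<le> 2 * real l ^ 2 * e" by (simp add: power2_eq_square algebra_simps)
  have "1 - (\<Sum>j\<in>{1..l}-{k}. p j) \<le> (\<Prod>j\<in>{1..l}-{k}. 1 - p j)"
  proof (rule Weierstrass_prod_ineq)
    fix j assume "j \<in> {1..l} - {k}"
    then show "p j \<in> {0..1}" using assms(1)[of j] assms(2)[of j] by simp
  qed
  then have "(1 - p k) * (1 - 2 * real l ^ 2 * e) \<le> (1 - p k) * (\<Prod>j\<in>{1..l}-{k}. 1 - p j)"
    using assms(2)[OF assms(4)] sm by (intro mult_left_mono) auto
  also have "\<dots> = (\<Prod>j\<in>{1..l}. 1 - p j)" using assms(4) by (simp add: prod.remove)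
  finally have "(1 - p k) * (1 - 2 * real l ^ 2 * e) \<le> (\<Prod>j\<in>{1..l}. 1 - p j)" .
  moreover have "p k * (2 * real l ^ 2 * e) \<ge> 0" using assms(1)[OF assms(4)] assms(6) by simp
  ultimately show ?thesis by (simp add: algebra_simps)
qed

text \<open>The threshold \<open>1 / (2 * real l)\<close> makes the densities sum to less than 1/2;
  the Weierstrass inequality does the rest.\<close>

lemma no_dominant_density:
  fixes p :: "nat \<Rightarrow> real"
  assumes "\<And>k. k \<in> {1..l} \<Longrightarrow> 0 \<le> p k" "l > 0"
    and "\<And>k. k \<in> {1..l} \<Longrightarrow> p k < 1 / (2 * real l)"
  shows "1/2 < (\<Prod>j\<in>{1..l}. 1 - p j)"
proof -
  have "(\<Sum>j\<in>{1..l}. p j) < (\<Sum>j\<in>{1..l}. 1 / (2 * real l))" using assms by (intro sum_strict_mono) auto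
  then have "(\<Sum>j\<in>{1..l}. p j) < 1/2" using assms(2) by simp
  moreover have "p k \<le> 1" if "k \<in> {1..l}" for k
  proof -
    have "1 / (2 * real l) \<le> 1" using assms(2) by simp
    with assms(3)[OF that] show ?thesis by linarith
  qed
  then have "1 - (\<Sum>j\<in>{1..l}. p j) \<le> (\<Prod>j\<in>{1..l}. 1 - p j)"
    using assms(1) by (intro Weierstrass_prod_ineq) auto
  ultimately show ?thesis by linarith
qed

section \<open>The order of magnitude\<close>

text \<open>The members avoiding the new point \<open>Suc n\<close> form a tuple on
  \<open>{1..n}\<close>. If no density at this point is large, they retain more than half of the
  product; if one dominates, it is at most 1/2, and they retain half up to an error paid for by the
  sum over pairs.\<close>

lemma s_star_Suc_le:
  assumes "l > 0"
  shows "real (s_star (Suc n) l m) \<le> 2 * s_star n l m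
    + 4 * real l ^ 2 * (\<Sum>S\<in>{S \<in> [{1..l}]\<^bsup>2\<^esup>. m S > 0}. real (s_star (Suc n) l (lower_on S m)))"
    (is "_ \<le> _ + _ * ?E")
proof -
  obtain F where F: "overlapping_on {1..Suc n} l m F" "(\<Prod>k\<in>{1..l}. card (F k)) = s_star (Suc n) l m"
    and down: "\<And>k A B. k \<in> {1..l} \<Longrightarrow> A \<in> F k \<Longrightarrow> B \<subseteq> A \<Longrightarrow> B \<in> F k"
    using s_star_attained_by_downsets by blast
  let ?s = "real (s_star (Suc n) l m)" and ?p = "\<lambda>k. density (F k) (Suc n)"
  have s: "?s > 0" using s_star_pos by simp
  have E: "?E \<ge> 0" by (intro sum_nonneg) auto
  \<comment> \<open>One quantity serves all pairs: a pair with \<open>m {i, j} > 0\<close> is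
    bounded by its own summand of \<open>?E\<close>, the others have product 0.\<close>
  have pair: "?p i * ?p j \<le> ?E / ?s" if ij: "i \<in> {1..l}" "j \<in> {1..l}" "i \<noteq> j" for i j
  proof (cases "m {i, j} = 0")
    case True
    have "(\<Prod>k\<in>{i, j}. ?p k) = 0"
      by (rule prod_density_eq_0[OF F(1), where S = "{i, j}"]) (use ij True in auto)
    then have "?p i * ?p j = 0" using ij(3) by simp
    then show ?thesis using E s by (simp only: divide_nonneg_pos)
  next
    case False
    have "(\<Prod>k\<in>{i, j}. ?p k) * ?s \<le> s_star (Suc n) l (lower_on {i, j} m)"
      by (rule prod_density_le[OF F]) (use ij in auto)
    also have "\<dots> \<le> ?E"
    proof (rule member_le_sum)
      show "finite {S \<in> [{1..l}]\<^bsup>2\<^esup>. m S > 0}"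
        by (intro finite_Collect_conjI disjI1) (simp add: finite_imp_finite_nsets)
    qed (use False ij in auto)
    finally show ?thesis using ij(3) s by (simp add: field_simps)
  qed
  have half: "?p k \<le> 1/2" if "k \<in> {1..l}" for k
    using card_insert_mem_density(2)[OF overlapping_on_finite[OF F(1) _ that]
        maximal_downsets_nonempty[OF F(2) that] down[OF that]] by simp
  have "{1..Suc n} - {Suc n} = {1..n}" by auto
  then have "(\<Prod>k\<in>{1..l}. card {A \<in> F k. Suc n \<notin> A}) \<le> s_star n l m"
    using prod_card_le_s_star overlapping_on_avoiding[OF F(1), of "Suc n"] by simp
  then have prod: "(\<Prod>k\<in>{1..l}. 1 - ?p k) * ?s \<le> s_star n l m"
    unfolding prod_codensity_eq[OF F] by (simp only: of_nat_le_iff)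
  show ?thesis
  proof (cases "\<exists>k\<in>{1..l}. ?p k \<ge> 1 / (2 * real l)")
    case True
    then obtain k where k: "k \<in> {1..l}" "?p k \<ge> 1 / (2 * real l)" by blast
    have "1 - ?p k \<le> (\<Prod>j\<in>{1..l}. 1 - ?p j) + 2 * real l ^ 2 * (?E / ?s)"
      by (rule dominant_density[where p = ?p, OF density_nonneg half pair k]) (use E s in auto)
    with half[OF k(1)] have "1/2 \<le> (\<Prod>j\<in>{1..l}. 1 - ?p j) + 2 * real l ^ 2 * (?E / ?s)" by linarith
    then have "1/2 * ?s \<le> ((\<Prod>j\<in>{1..l}. 1 - ?p j) + 2 * real l ^ 2 * (?E / ?s)) * ?s"
      using s by (intro mult_right_mono) auto
    also have "\<dots> = (\<Prod>j\<in>{1..l}. 1 - ?p j) * ?s + 2 * real l ^ 2 * ?E"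
      using s by (simp add: algebra_simps)
    finally show ?thesis using prod by simp
  next
    case False
    then have "1/2 < (\<Prod>j\<in>{1..l}. 1 - ?p j)"
      by (intro no_dominant_density density_nonneg assms) (auto simp: not_le)
    then have "1/2 * ?s \<le> (\<Prod>j\<in>{1..l}. 1 - ?p j) * ?s" using s by (intro mult_right_mono) auto
    moreover have "4 * real l ^ 2 * ?E \<ge> 0" using E by simp
    ultimately show ?thesis using prod by linarith
  qed
qed

lemma s_star_0_le: "s_star 0 l m \<le> 1"
proof -
  obtain F where F: "overlapping_on {1..0} l m F" "(\<Prod>k\<in>{1..l}. card (F k)) = s_star 0 l m"
    by (rule s_star_attained_by_downsets)
  have le1: "card (F k) \<le> 1" if "k \<in> {1..l}" for k
  proof -
    have "F k \<subseteq> {{}}"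
    proof
      fix A assume "A \<in> F k"
      then have "A \<subseteq> {1..0}" by (rule overlapping_on_subset[OF F(1) that])
      then show "A \<in> {{}}" by simp
    qed
    then have "card (F k) \<le> card {{} :: nat set}" by (intro card_mono) auto
    then show ?thesis by simp
  qed
  have "(\<Prod>k\<in>{1..l}. card (F k)) \<le> 1" by (rule prod_le_1) (blast intro: le1)
  then show ?thesis using F(2) by simp
qed

lemma finite_pairs: "finite ([{1..l::nat}]\<^bsup>2\<^esup>)"
  by (simp add: finite_imp_finite_nsets)

lemma pair_subset_pair:
  assumes "S \<in> [A]\<^bsup>k\<^esup>" "T \<in> [A]\<^bsup>k\<^esup>" "S \<subseteq> T"
  shows "S = T"
  using assms by (intro card_subset_eq) (auto simp: nsets_def)

lemma sum_lower_on_pair: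
  assumes "S \<in> [{1..l}]\<^bsup>2\<^esup>" "m S > 0"
  shows "Suc (\<Sum>T\<in>[{1..l}]\<^bsup>2\<^esup>. lower_on S m T) = (\<Sum>T\<in>[{1..l}]\<^bsup>2\<^esup>. m T)"
proof -
  have "(\<Sum>T\<in>[{1..l}]\<^bsup>2\<^esup> - {S}. lower_on S m T) = (\<Sum>T\<in>[{1..l}]\<^bsup>2\<^esup> - {S}. m T)"
    using pair_subset_pair[OF _ assms(1)] by (intro sum.cong) (auto simp: lower_on_def)
  moreover have "Suc (lower_on S m S) = m S" using assms(2) by (simp add: lower_on_def)
  ultimately show ?thesis
    using sum.remove[OF finite_pairs assms(1), of m] sum.remove[OF finite_pairs assms(1), of "lower_on S m"]
    by linarith
qed

text \<open>Outer induction on the total weight \<open>M\<close>, inner induction on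
  \<open>n\<close>. The constant is uniform in \<open>m\<close> because the recursion passes to
  several lowered vectors of the same smaller weight.\<close>

lemma s_star_upper_bound:
  assumes "l > 0"
  shows "\<exists>C\<ge>0. \<forall>m. (\<Sum>S\<in>[{1..l}]\<^bsup>2\<^esup>. m S) = M \<longrightarrow> (\<forall>n. real (s_star n l m) \<le> C * 2 ^ n * (real n + 1) ^ M)"
proof (induction M)
  case 0
  have "real (s_star n l m) \<le> 1 * 2 ^ n * (real n + 1) ^ 0"
    if "(\<Sum>S\<in>[{1..l}]\<^bsup>2\<^esup>. m S) = 0" for m n
  proof (induction n)
    case 0
    then show ?case using s_star_0_le[of l m] by simp
  next
    case (Suc n)
    \<comment> \<open>With total weight 0 the error sum of \<open>s_star_Suc_le\<close> is empty and
      the recursion is plain doubling.\<close>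
    have "{S \<in> [{1..l}]\<^bsup>2\<^esup>. m S > 0} = {}" using that finite_pairs by auto
    then have "real (s_star (Suc n) l m) \<le> 2 * real (s_star n l m)"
      using s_star_Suc_le[OF assms, of n m] by (simp only: sum.empty)
    also have "\<dots> \<le> 2 * (1 * 2 ^ n * (real n + 1) ^ 0)" using Suc by (intro mult_left_mono) auto
    finally show ?case by simp
  qed
  then show ?case by (intro exI[of _ 1]) simp
next
  case (Suc M)
  then obtain C where C: "C \<ge> 0"
    "\<And>m n. (\<Sum>S\<in>[{1..l}]\<^bsup>2\<^esup>. m S) = M \<Longrightarrow> real (s_star n l m) \<le> C * 2 ^ n * (real n + 1) ^ M"
    by blast
  \<comment> \<open>The second summand is the error of one step of the recursion, bounded by the
    outer hypothesis for every pair; the 1 settles \<open>n = 0\<close>.\<close>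
  define D where "D = 1 + 4 * real l ^ 2 * (card ([{1..l}]\<^bsup>2\<^esup>) * C)"
  have D: "D \<ge> 1" using C(1) by (simp add: D_def)
  have "real (s_star n l m) \<le> D * 2 ^ n * (real n + 1) ^ Suc M"
    if m: "(\<Sum>S\<in>[{1..l}]\<^bsup>2\<^esup>. m S) = Suc M" for m n
  proof (induction n)
    case 0
    have "real (s_star 0 l m) \<le> 1" using s_star_0_le[of l m] by simp
    with D show ?case by simp
  next
    case (Suc n)
    let ?Q = "{S \<in> [{1..l}]\<^bsup>2\<^esup>. m S > 0}" and ?B = "2 ^ Suc n * (real (Suc n) + 1) ^ M"
    have "(\<Sum>S\<in>?Q. real (s_star (Suc n) l (lower_on S m))) \<le> (\<Sum>S\<in>?Q. C * ?B)"
    proof (rule sum_mono)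
      fix S assume "S \<in> ?Q"
      then have "(\<Sum>T\<in>[{1..l}]\<^bsup>2\<^esup>. lower_on S m T) = M"
        using sum_lower_on_pair[of S l m] m by simp
      from C(2)[OF this, of "Suc n"] show "real (s_star (Suc n) l (lower_on S m)) \<le> C * ?B"
        by (simp only: mult.assoc)
    qed
    also have "\<dots> = card ?Q * (C * ?B)" by simp
    also have "\<dots> \<le> card ([{1..l}]\<^bsup>2\<^esup>) * (C * ?B)"
      using C(1) finite_pairs by (intro mult_right_mono of_nat_mono card_mono) auto
    finally have "4 * real l ^ 2 * (\<Sum>S\<in>?Q. real (s_star (Suc n) l (lower_on S m)))
        \<le> 4 * real l ^ 2 * (card ([{1..l}]\<^bsup>2\<^esup>) * (C * ?B))"
      by (intro mult_left_mono) auto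
    also have "\<dots> = (D - 1) * ?B" by (simp add: D_def)
    also have "\<dots> \<le> D * ?B" by (intro mult_right_mono) auto
    finally have "real (s_star (Suc n) l m) \<le> 2 * (D * 2 ^ n * (real n + 1) ^ Suc M) + D * ?B"
      using s_star_Suc_le[OF assms, of n m] Suc by linarith
    \<comment> \<open>With one factor \<open>real n + 1\<close> split off, the inductive term and
      the error add up to \<open>n + 2\<close> copies of the same quantity.\<close>
    also have "2 * (D * 2 ^ n * (real n + 1) ^ Suc M) = (real n + 1) * (D * 2 ^ Suc n * (real n + 1) ^ M)"
      by simp
    also have "\<dots> \<le> (real n + 1) * (D * 2 ^ Suc n * (real (Suc n) + 1) ^ M)"
      using D by (intro mult_left_mono power_mono) auto
    also have "\<dots> + D * ?B = D * 2 ^ Suc n * (real (Suc n) + 1) ^ Suc M" by (simp add: algebra_simps)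
    finally show ?case by simp
  qed
  then show ?case using D by (intro exI[of _ D]) simp
qed

section \<open>Extremal tuples of downsets\<close>

text \<open>Fubini for a finite product: if, for every choice of the other coordinates, at most a
  fraction \<open>\<delta>\<close> of the values at \<open>k\<close> is bad, then at most a fraction
  \<open>\<delta>\<close> of all tuples is bad.\<close>

lemma card_PiE_filter_le:
  fixes F :: "'i \<Rightarrow> 'a set" and \<delta> :: real
  assumes "finite I" "\<And>i. i \<in> I \<Longrightarrow> finite (F i)" "k \<in> I"
    and le: "\<And>C. C \<in> PiE (I - {k}) F \<Longrightarrow> real (card {a \<in> F k. Q (C(k := a))}) \<le> \<delta> * card (F k)"
  shows "real (card {A \<in> PiE I F. Q A}) \<le> \<delta> * card (PiE I F)"
proof -
  let ?J = "PiE (I - {k}) F"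
  have finJ: "finite ?J" using assms(1,2) by (intro finite_PiE) auto
  have I: "insert k (I - {k}) = I" using assms(3) by blast
  have sub: "{A \<in> PiE I F. Q A} \<subseteq> (\<lambda>(C, a). C(k := a)) ` (SIGMA C:?J. {a \<in> F k. Q (C(k := a))})"
  proof
    fix A assume "A \<in> {A \<in> PiE I F. Q A}"
    then have A: "A \<in> PiE (insert k (I - {k})) F" "Q A" using I by auto
    have "A(k := undefined) \<in> ?J" by (rule fun_upd_in_PiE[OF _ A(1)]) simp
    moreover have "A k \<in> F k" using A(1) by (rule PiE_mem) simp
    ultimately show "A \<in> (\<lambda>(C, a). C(k := a)) ` (SIGMA C:?J. {a \<in> F k. Q (C(k := a))})"
      using A(2) by (intro image_eqI[of _ _ "(A(k := undefined), A k)"]) auto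
  qed
  have fin: "finite (SIGMA C:?J. {a \<in> F k. Q (C(k := a))})"
    using finJ assms(2,3) by (intro finite_SigmaI) auto
  have "card {A \<in> PiE I F. Q A} \<le> card (SIGMA C:?J. {a \<in> F k. Q (C(k := a))})"
    by (rule order_trans[OF card_mono[OF _ sub] card_image_le[OF fin]]) (rule finite_imageI[OF fin])
  also have "\<dots> = (\<Sum>C\<in>?J. card {a \<in> F k. Q (C(k := a))})"
    using finJ assms(2,3) by (intro card_SigmaI) auto
  finally have "real (card {A \<in> PiE I F. Q A}) \<le> real (\<Sum>C\<in>?J. card {a \<in> F k. Q (C(k := a))})"
    by (rule of_nat_mono)
  also have "\<dots> \<le> (\<Sum>C\<in>?J. \<delta> * card (F k))" unfolding of_nat_sum by (rule sum_mono) (rule le)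
  also have "\<dots> = \<delta> * (card ?J * card (F k))" by simp
  also have "card ?J * card (F k) = card (PiE I F)"
    using assms(1,3) by (simp add: card_PiE prod.remove[of I k])
  finally show ?thesis by simp
qed

text \<open>In the application \<open>e\<close> and \<open>h\<close> are of order \<open>1/n\<close> and \<open>1/n^3\<close>.\<close>

locale extremal_tuple =
  fixes n l :: nat and m :: "nat set \<Rightarrow> nat" and F :: "nat \<Rightarrow> nat set set" and e h :: real
  assumes l_pos: "l > 0"
    and overlap: "overlapping_on {1..n} l m F"
    and extremal: "(\<Prod>k\<in>{1..l}. card (F k)) = s_star n l m"
    and downset: "k \<in> {1..l} \<Longrightarrow> A \<in> F k \<Longrightarrow> B \<subseteq> A \<Longrightarrow> B \<in> F k"
    and e_nonneg: "e \<ge> 0" and h_nonneg: "h \<ge> 0"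
    and lower_pair: "K \<in> [{1..l}]\<^bsup>2\<^esup> \<Longrightarrow> m K > 0 \<Longrightarrow> real (s_star n l (lower_on K m)) \<le> e * s_star n l m"
    and lower_triple: "K \<in> [{1..l}]\<^bsup>3\<^esup> \<Longrightarrow> (\<And>S. S \<in> [K]\<^bsup>2\<^esup> \<Longrightarrow> m S > 0) \<Longrightarrow>
      real (s_star n l (lower_on K m)) \<le> h * s_star n l m"
begin

section \<open>Densities in an extremal tuple\<close>

abbreviation p :: "nat \<Rightarrow> nat \<Rightarrow> real" where
  "p k y \<equiv> density (F k) y"

lemma fin: "k \<in> {1..l} \<Longrightarrow> finite (F k)"
  by (rule overlapping_on_finite[OF overlap]) simp

lemma nonempty: "k \<in> {1..l} \<Longrightarrow> F k \<noteq> {}"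
  by (rule maximal_downsets_nonempty[OF extremal])

lemma s_pos: "real (s_star n l m) > 0"
  using s_star_pos by simp

lemma p_le_half: "k \<in> {1..l} \<Longrightarrow> p k y \<le> 1/2"
  by (rule card_insert_mem_density(2)[OF fin nonempty downset])

lemma p_pair_le:
  assumes "i \<in> {1..l}" "j \<in> {1..l}" "i \<noteq> j"
  shows "p i y * p j y \<le> e"
proof (cases "m {i, j} = 0")
  case True
  have "(\<Prod>k\<in>{i, j}. p k y) = 0"
    by (rule prod_density_eq_0[OF overlap, where S = "{i, j}"]) (use assms True in auto)
  then have "p i y * p j y = 0" using assms(3) by simp
  then show ?thesis using e_nonneg by (simp only:)
next
  case False
  have "(\<Prod>k\<in>{i, j}. p k y) * s_star n l m \<le> s_star n l (lower_on {i, j} m)"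
    by (rule prod_density_le[OF overlap extremal]) (use assms in auto)
  also have "\<dots> \<le> e * s_star n l m" by (rule lower_pair) (use False assms in auto)
  finally show ?thesis using assms(3) s_pos by simp
qed

lemma p_triple_le:
  assumes "i \<in> {1..l}" "j \<in> {1..l}" "k \<in> {1..l}" "i \<noteq> j" "i \<noteq> k" "j \<noteq> k"
  shows "p k y * (p i y * p j y) \<le> h"
proof (cases "\<exists>S\<in>[{i, j, k}]\<^bsup>2\<^esup>. m S = 0")
  case True
  then obtain S where S: "S \<in> [{i, j, k}]\<^bsup>2\<^esup>" "m S = 0" by blast
  have "(\<Prod>t\<in>{i, j, k}. p t y) = 0"
    by (rule prod_density_eq_0[where m = m and S = S, OF overlap _ S]) (use assms in auto)
  then show ?thesis using assms(4-6) h_nonneg by (auto simp: mult_ac)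
next
  case False
  have "(\<Prod>t\<in>{i, j, k}. p t y) * s_star n l m \<le> s_star n l (lower_on {i, j, k} m)"
    by (rule prod_density_le[OF overlap extremal]) (use assms in auto)
  also have "\<dots> \<le> h * s_star n l m"
  proof (rule lower_triple)
    show "{i, j, k} \<in> [{1..l}]\<^bsup>3\<^esup>" using assms by (auto simp: nsets_def)
  qed (use False in auto)
  finally show ?thesis using assms(4-6) s_pos by (simp add: mult_ac)
qed

text \<open>Twice the error term of \<open>dominant_density\<close>: a home density is at least
  \<open>(1 - d) / 2\<close>.\<close>

definition d :: real where "d = 4 * real l ^ 2 * e"

lemma d_nonneg: "d \<ge> 0"
  using e_nonneg by (simp add: d_def)

text \<open>The members avoiding \<open>y\<close> make up at most half of the maximal product, so each ground element \<open>y\<close> has some family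
  in which it is frequent, its \<open>home\<close>; as \<open>p i y * p j y \<le> e\<close>, it is rare in all others.\<close>

definition home :: "nat \<Rightarrow> nat" where
  "home y = (SOME k. k \<in> {1..l} \<and> p k y \<ge> 1 / (2 * real l))"

lemma home:
  assumes "y \<in> {1..n}"
  shows "home y \<in> {1..l}" "p (home y) y \<ge> 1 / (2 * real l)"
proof -
  have "\<not> 1/2 < (\<Prod>k\<in>{1..l}. 1 - p k y)"
  proof
    assume "1/2 < (\<Prod>k\<in>{1..l}. 1 - p k y)"
    then have *: "1/2 * real (s_star n l m) < (\<Prod>k\<in>{1..l}. 1 - p k y) * s_star n l m"
      using s_pos by (intro mult_strict_right_mono)
    have "2 * (\<Prod>k\<in>{1..l}. card {A \<in> F k. y \<notin> A}) \<le> s_star n l m"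
      by (rule prod_card_avoiding_le_s_star[OF overlapping_on_avoiding[OF overlap] assms l_pos])
    then have "2 * real (\<Prod>k\<in>{1..l}. card {A \<in> F k. y \<notin> A}) \<le> s_star n l m" by linarith
    then show False using * unfolding prod_codensity_eq[OF overlap extremal] by linarith
  qed
  then have "\<exists>k. k \<in> {1..l} \<and> p k y \<ge> 1 / (2 * real l)"
    using no_dominant_density[of l "\<lambda>k. p k y", OF density_nonneg l_pos] by (meson not_le)
  from someI_ex[OF this] show "home y \<in> {1..l}" "p (home y) y \<ge> 1 / (2 * real l)"
    unfolding home_def by blast+
qed

text \<open>At most half of the maximal product avoids \<open>y\<close>, and
  \<open>dominant_density\<close> transfers this to the home family alone; what \<open>y\<close>
  cannot enlarge there is the fraction \<open>1 - 2 * p k y\<close>.\<close>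

lemma card_insert_notin_le:
  assumes "y \<in> {1..n}" "home y = k"
  shows "real (card {A \<in> F k. insert y A \<notin> F k}) \<le> d * card (F k)"
proof -
  have k: "k \<in> {1..l}" "p k y \<ge> 1 / (2 * real l)" using home[OF assms(1)] assms(2) by auto
  have "1 - p k y \<le> (\<Prod>j\<in>{1..l}. 1 - p j y) + 2 * real l ^ 2 * e"
    by (rule dominant_density[where p = "\<lambda>j. p j y", OF density_nonneg p_le_half p_pair_le k e_nonneg])
  moreover have "(\<Prod>j\<in>{1..l}. 1 - p j y) \<le> 1/2"
  proof -
    have "2 * (\<Prod>k\<in>{1..l}. card {A \<in> F k. y \<notin> A}) \<le> s_star n l m"
      by (rule prod_card_avoiding_le_s_star[OF overlapping_on_avoiding[OF overlap] assms(1) l_pos])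
    then have "2 * real (\<Prod>k\<in>{1..l}. card {A \<in> F k. y \<notin> A}) \<le> s_star n l m" by linarith
    then show ?thesis
      unfolding prod_codensity_eq[OF overlap extremal, symmetric] using s_pos by simp
  qed
  ultimately have "1 - 2 * p k y \<le> d" unfolding d_def by linarith
  then have "(1 - 2 * p k y) * card (F k) \<le> d * card (F k)" by (rule mult_right_mono) simp
  then show ?thesis
    using card_insert_mem_density(1)[OF fin[OF k(1)] nonempty[OF k(1)] downset[OF k(1)], where y = y] by simp
qed

text \<open>The points of \<open>Z\<close> are added one at a time. Failure at a new point
  \<open>y\<close> means that \<open>A \<union> Z\<close> is a member which \<open>y\<close> cannot
  enlarge, and each such member arises from at most \<open>2 ^ card Z\<close> sets \<open>A\<close>.
  So the bound doubles with each point.\<close>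

lemma card_Un_notin_le:
  assumes "finite Z" "Z \<subseteq> {y \<in> {1..n}. home y = k}" "k \<in> {1..l}"
  shows "real (card {A \<in> F k. A \<union> Z \<notin> F k}) \<le> 2 ^ card Z * d * card (F k)"
  using assms
proof (induction Z rule: finite_induct)
  case empty
  then show ?case using d_nonneg by simp
next
  case (insert y Z)
  let ?T = "{B \<in> F k. insert y B \<notin> F k}"
  let ?U = "{A \<in> F k. A \<union> Z \<in> ?T}"
  \<comment> \<open>\<open>A\<close> is recovered from its trace on \<open>Z\<close> and from
    \<open>A \<union> Z\<close>.\<close>
  have "?U \<subseteq> (\<lambda>(W, B). W \<union> (B - Z)) ` (Pow Z \<times> ?T)"
  proof
    fix A assume A: "A \<in> ?U"
    have "A = (\<lambda>(W, B). W \<union> (B - Z)) (A \<inter> Z, A \<union> Z)" by auto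
    moreover have "(A \<inter> Z, A \<union> Z) \<in> Pow Z \<times> ?T" using A by blast
    ultimately show "A \<in> (\<lambda>(W, B). W \<union> (B - Z)) ` (Pow Z \<times> ?T)" by (rule image_eqI)
  qed
  moreover have finT: "finite (Pow Z \<times> ?T)" using fin[OF insert.prems(2)] insert.hyps by simp
  ultimately have "card ?U \<le> card (Pow Z \<times> ?T)" by (meson surj_card_le)
  also have "\<dots> = 2 ^ card Z * card ?T" using insert.hyps by (simp add: card_cartesian_product card_Pow)
  finally have "real (card ?U) \<le> 2 ^ card Z * real (card ?T)"
    by (simp flip: of_nat_le_iff[where 'a = real])
  also have "\<dots> \<le> 2 ^ card Z * (d * card (F k))"
    using card_insert_notin_le[of y k] insert.prems by (intro mult_left_mono) auto
  finally have U: "real (card ?U) \<le> 2 ^ card Z * d * card (F k)" by simp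
  have "{A \<in> F k. A \<union> insert y Z \<notin> F k} \<subseteq> {A \<in> F k. A \<union> Z \<notin> F k} \<union> ?U"
    unfolding Un_insert_right by blast
  then have "card {A \<in> F k. A \<union> insert y Z \<notin> F k} \<le> card ({A \<in> F k. A \<union> Z \<notin> F k} \<union> ?U)"
    using fin[OF insert.prems(2)] by (intro card_mono) auto
  also have "\<dots> \<le> card {A \<in> F k. A \<union> Z \<notin> F k} + card ?U" by (rule card_Un_le)
  finally have "real (card {A \<in> F k. A \<union> insert y Z \<notin> F k})
      \<le> real (card {A \<in> F k. A \<union> Z \<notin> F k}) + real (card ?U)" by linarith
  also have "\<dots> \<le> 2 ^ card Z * d * card (F k) + 2 ^ card Z * d * card (F k)"
    using insert.prems by (intro add_mono U insert.IH) auto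
  finally show ?case using insert.hyps by (simp add: mult_ac)
qed

section \<open>Home blocks and good tuples\<close>

definition block :: "nat \<Rightarrow> nat set" where
  "block k = {y \<in> {1..n}. home y = k}"

text \<open>Suppose \<open>B\<close> had a set \<open>Z\<close> of \<open>m {i, j} + 1\<close>
  points in the block. The bound on \<open>d\<close> says that not all members of \<open>F i\<close>
  fail to absorb \<open>Z\<close>, and one that absorbs it overlaps \<open>B\<close> too
  much.\<close>

lemma card_Int_block_le:
  assumes "i \<in> {1..l}" "j \<in> {1..l}" "i \<noteq> j" "B \<in> F j" "2 ^ Suc (m {i, j}) * d < 1"
  shows "card (B \<inter> block i) \<le> m {i, j}"
proof (rule ccontr)
  assume "\<not> ?thesis"
  then have "Suc (m {i, j}) \<le> card (B \<inter> block i)" by simp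
  then obtain Z where Z: "Z \<subseteq> B \<inter> block i" "card Z = Suc (m {i, j})" "finite Z"
    by (rule obtain_subset_with_card_n)
  have "real (card {A \<in> F i. A \<union> Z \<notin> F i}) \<le> 2 ^ card Z * d * card (F i)"
    by (rule card_Un_notin_le[OF Z(3) _ assms(1)]) (use Z(1) in \<open>unfold block_def, blast\<close>)
  also have "\<dots> < 1 * real (card (F i))"
    using Z(2) assms(5) fin[OF assms(1)] nonempty[OF assms(1)]
    by (intro mult_strict_right_mono) (auto simp: card_gt_0_iff)
  finally have "card {A \<in> F i. A \<union> Z \<notin> F i} < card (F i)" by simp
  then have "{A \<in> F i. A \<union> Z \<notin> F i} \<noteq> F i" by auto
  then obtain A where A: "A \<in> F i" "A \<union> Z \<in> F i" by blast
  have "card Z \<le> card ((A \<union> Z) \<inter> B)"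
    using Z(1) overlapping_on_finite_mem[OF overlap finite_atLeastAtMost assms(2,4)]
    by (intro card_mono) blast+
  also have "\<dots> \<le> m {i, j}" by (rule overlapping_onD[OF overlap assms(1-3) A(2) assms(4)])
  finally show False using Z(2) by simp
qed

text \<open>Outside its home, \<open>y\<close> has density \<open>O(n powr (-3/2))\<close> in all families but one: linking the
  home and two further families at \<open>y\<close> lowers three of the bounds \<open>m\<close>.\<close>

definition guest :: "nat \<Rightarrow> nat" where
  "guest y = (SOME k. k \<in> {1..l} - {home y} \<and> (\<forall>j\<in>{1..l} - {home y}. p j y \<le> p k y))"

text \<open>The guest is the most frequent family other than the home, so
  \<open>p k y ^ 2 \<le> p k y * p (guest y) y\<close>. Dividing the triple bound \<open>h\<close>
  by the home density gives \<open>2 * real l * h\<close>.\<close>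

lemma p_neither_le:
  assumes "y \<in> {1..n}" "k \<in> {1..l}" "k \<noteq> home y" "k \<noteq> guest y"
  shows "p k y \<le> sqrt (2 * real l * h)"
proof -
  let ?S = "{1..l} - {home y}"
  \<comment> \<open>The set contains \<open>k\<close>, so a maximizer exists and the choice in
    \<open>guest\<close> is justified.\<close>
  have "Max ((\<lambda>k. p k y) ` ?S) \<in> (\<lambda>k. p k y) ` ?S"
    by (rule Max_in) (use assms in auto)
  then obtain g where "g \<in> ?S" "Max ((\<lambda>k. p k y) ` ?S) = p g y" by blast
  then have "g \<in> ?S \<and> (\<forall>j\<in>?S. p j y \<le> p g y)"
    by (intro conjI ballI) (simp_all flip: \<open>Max _ = _\<close>)
  then have "\<exists>k. k \<in> ?S \<and> (\<forall>j\<in>?S. p j y \<le> p k y)" by blast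
  from someI_ex[OF this] have "guest y \<in> ?S \<and> (\<forall>j\<in>?S. p j y \<le> p (guest y) y)"
    unfolding guest_def[symmetric] .
  then have g: "guest y \<in> ?S" "p k y \<le> p (guest y) y" using assms by blast+
  have "1 / (2 * real l) * (p k y * p (guest y) y) \<le> p (home y) y * (p k y * p (guest y) y)"
    by (intro mult_right_mono home[OF assms(1)] mult_nonneg_nonneg density_nonneg)
  also have "\<dots> \<le> h"
    using home(1)[OF assms(1)] g assms by (intro p_triple_le) auto
  finally have "p k y * p (guest y) y \<le> 2 * real l * h" using l_pos by (simp add: field_simps)
  then have "p k y ^ 2 \<le> 2 * real l * h"
    using mult_left_mono[OF g(2) density_nonneg[of "F k" y]] by (simp add: power2_eq_square)
  then show ?thesis by (rule real_le_rsqrt)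
qed

text \<open>The second condition turns every point of \<open>A j\<close> with home \<open>i\<close>
  into a common point of two members, namely of \<open>A j\<close> and the enlarged
  \<open>A i\<close>, so that the overlap bound controls it.\<close>

definition good :: "(nat \<Rightarrow> nat set) set" where
  "good = {A \<in> PiE {1..l} F.
     (\<forall>k\<in>{1..l}. \<forall>y\<in>A k. k \<in> {home y, guest y}) \<and>
     (\<forall>i\<in>{1..l}. \<forall>j\<in>{1..l} - {i}. A i \<union> (A j \<inter> block i) \<in> F i)}"

text \<open>Union bound: \<open>l * n\<close> events that a point is used by a family which is
  neither its home nor its guest, and \<open>l ^ 2\<close> events that a member cannot absorb a
  trace. By \<open>card_Int_block_le\<close> such a trace has at most \<open>M\<close>
  points.\<close>

lemma card_good_ge:
  assumes "\<And>S. S \<in> [{1..l}]\<^bsup>2\<^esup> \<Longrightarrow> m S \<le> M" "2 ^ Suc M * d < 1"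
  shows "(1 - (real l * real n * sqrt (2 * real l * h) + real l ^ 2 * 2 ^ M * d)) * s_star n l m \<le> card good"
proof -
  let ?O = "PiE {1..l} F"
  have finO: "finite ?O" using fin by (intro finite_PiE) auto
  have cardO: "card ?O = s_star n l m" using extremal by (simp add: card_PiE)
  define P where "P = (\<lambda>k y. {A \<in> ?O. y \<in> A k \<and> k \<notin> {home y, guest y}})"
  \<comment> \<open>The conjunct \<open>i \<noteq> j\<close> empties the diagonal, so that the union
    can run over all \<open>i\<close> and \<open>j\<close>.\<close>
  define N where "N = (\<lambda>i j. {A \<in> ?O. i \<noteq> j \<and> A i \<union> (A j \<inter> block i) \<notin> F i})"
  have finPN: "finite (P k y)" "finite (N i j)" for k y i j
    unfolding P_def N_def using finO by simp_all
  have P: "real (card (P k y)) \<le> sqrt (2 * real l * h) * s_star n l m" if ky: "k \<in> {1..l}" "y \<in> {1..n}" for k y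
  proof (cases "k \<in> {home y, guest y}")
    case True
    then have "P k y = {}" unfolding P_def by blast
    then show ?thesis using h_nonneg by simp
  next
    case False
    have "real (card {A \<in> ?O. y \<in> A k}) \<le> sqrt (2 * real l * h) * card ?O"
    proof (rule card_PiE_filter_le[where k = k and Q = "\<lambda>A. y \<in> A k"])
      show "finite (F i)" if "i \<in> {1..l}" for i by (rule fin[OF that])
      show "k \<in> {1..l}" by fact
      fix C
      have "real (card {a \<in> F k. y \<in> a}) = p k y * card (F k)"
        using fin[OF ky(1)] nonempty[OF ky(1)] by (simp add: density_def)
      also have "\<dots> \<le> sqrt (2 * real l * h) * card (F k)"
        using p_neither_le[OF ky(2,1)] False by (intro mult_right_mono) auto
      finally show "real (card {a \<in> F k. y \<in> (C(k := a)) k}) \<le> sqrt (2 * real l * h) * card (F k)" by simp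
    qed simp
    moreover have "P k y = {A \<in> ?O. y \<in> A k}" using False unfolding P_def by blast
    ultimately show ?thesis using cardO by simp
  qed
  have N: "real (card (N i j)) \<le> 2 ^ M * d * s_star n l m" if ij: "i \<in> {1..l}" "j \<in> {1..l}" for i j
  proof (cases "i = j")
    case True
    then show ?thesis using d_nonneg by (simp add: N_def)
  next
    case False
    have "real (card {A \<in> ?O. A i \<union> (A j \<inter> block i) \<notin> F i}) \<le> 2 ^ M * d * card ?O"
    proof (rule card_PiE_filter_le[where k = i and Q = "\<lambda>A. A i \<union> (A j \<inter> block i) \<notin> F i"])
      show "finite (F i)" if "i \<in> {1..l}" for i by (rule fin[OF that])
      show "i \<in> {1..l}" by fact
      fix C assume C': "C \<in> PiE ({1..l} - {i}) F"
      have C: "C j \<in> F j" by (rule PiE_mem[OF C']) (use ij False in simp)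
      have mM: "m {i, j} \<le> M" using assms(1) ij False by simp
      have "2 ^ Suc (m {i, j}) * d \<le> 2 ^ Suc M * d"
        using mM d_nonneg by (intro mult_right_mono power_increasing) auto
      then have "card (C j \<inter> block i) \<le> m {i, j}"
        using assms(2) by (intro card_Int_block_le[OF ij False C]) linarith
      then have cM: "card (C j \<inter> block i) \<le> M" using mM by linarith
      have "real (card {a \<in> F i. a \<union> (C j \<inter> block i) \<notin> F i}) \<le> 2 ^ card (C j \<inter> block i) * d * card (F i)"
        by (rule card_Un_notin_le[OF _ _ ij(1)]) (simp_all add: block_def subset_iff)
      also have "\<dots> \<le> 2 ^ M * d * card (F i)"
        using cM d_nonneg by (intro mult_right_mono power_increasing) auto
      finally show "real (card {a \<in> F i. (C(i := a)) i \<union> ((C(i := a)) j \<inter> block i) \<notin> F i}) \<le> 2 ^ M * d * card (F i)"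
        using False by simp
    qed simp
    then show ?thesis using False cardO by (simp add: N_def)
  qed
  let ?B = "(\<Union>k\<in>{1..l}. \<Union>y\<in>{1..n}. P k y) \<union> (\<Union>i\<in>{1..l}. \<Union>j\<in>{1..l}. N i j)"
  have "?O \<subseteq> good \<union> ?B"
  proof
    fix A assume A: "A \<in> ?O"
    have mem: "y \<in> {1..n}" if "k \<in> {1..l}" "y \<in> A k" for k y
      using overlapping_on_subset[OF overlap that(1) PiE_mem[OF A that(1)]] that(2) by blast
    show "A \<in> good \<union> ?B"
    proof (cases "A \<in> good")
      case False
      have "A \<in> good" if "(\<forall>k\<in>{1..l}. \<forall>y\<in>A k. k \<in> {home y, guest y}) \<and>
          (\<forall>i\<in>{1..l}. \<forall>j\<in>{1..l} - {i}. A i \<union> (A j \<inter> block i) \<in> F i)"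
        unfolding good_def mem_Collect_eq by (rule conjI[OF A that])
      with False consider k y where "k \<in> {1..l}" "y \<in> A k" "k \<notin> {home y, guest y}"
        | i j where "i \<in> {1..l}" "j \<in> {1..l} - {i}" "A i \<union> (A j \<inter> block i) \<notin> F i"
        by meson
      then show ?thesis
      proof cases
        case 1
        then have "A \<in> P k y" using A by (simp add: P_def)
        then show ?thesis using 1(1) mem[OF 1(1,2)] by blast
      next
        case 2
        then have "A \<in> N i j" using A by (simp add: N_def)
        then show ?thesis using 2 by blast
      qed
    qed simp
  qed
  moreover have "finite (good \<union> ?B)"
    by (intro finite_UnI finite_UN_I finite_atLeastAtMost finPN)
      (unfold good_def, rule finite_subset[OF Collect_restrict finO])
  ultimately have "card ?O \<le> card (good \<union> ?B)" by (intro card_mono)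
  also have "\<dots> \<le> card good + card ?B" by (rule card_Un_le)
  finally have 1: "real (s_star n l m) \<le> card good + real (card ?B)" using cardO by linarith
  have "card ?B \<le> card (\<Union>k\<in>{1..l}. \<Union>y\<in>{1..n}. P k y) + card (\<Union>i\<in>{1..l}. \<Union>j\<in>{1..l}. N i j)"
    by (rule card_Un_le)
  also have "card (\<Union>k\<in>{1..l}. \<Union>y\<in>{1..n}. P k y) \<le> (\<Sum>k\<in>{1..l}. \<Sum>y\<in>{1..n}. card (P k y))"
    by (rule order_trans[OF card_UN_le[OF finite_atLeastAtMost] sum_mono[OF card_UN_le[OF finite_atLeastAtMost]]])
  also have "card (\<Union>i\<in>{1..l}. \<Union>j\<in>{1..l}. N i j) \<le> (\<Sum>i\<in>{1..l}. \<Sum>j\<in>{1..l}. card (N i j))"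
    by (rule order_trans[OF card_UN_le[OF finite_atLeastAtMost] sum_mono[OF card_UN_le[OF finite_atLeastAtMost]]])
  finally have "card ?B \<le>
      (\<Sum>k\<in>{1..l}. \<Sum>y\<in>{1..n}. card (P k y)) + (\<Sum>i\<in>{1..l}. \<Sum>j\<in>{1..l}. card (N i j))"
    by simp
  then have "real (card ?B) \<le>
      real ((\<Sum>k\<in>{1..l}. \<Sum>y\<in>{1..n}. card (P k y)) + (\<Sum>i\<in>{1..l}. \<Sum>j\<in>{1..l}. card (N i j)))"
    by (rule of_nat_mono)
  also have "\<dots> \<le> (\<Sum>k\<in>{1..l}. \<Sum>y\<in>{1..n}. sqrt (2 * real l * h) * s_star n l m)
      + (\<Sum>i\<in>{1..l}. \<Sum>j\<in>{1..l}. 2 ^ M * d * s_star n l m)"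
    unfolding of_nat_add of_nat_sum by (intro add_mono sum_mono P N)
  also have "\<dots> = (real l * real n * sqrt (2 * real l * h) + real l ^ 2 * 2 ^ M * d) * s_star n l m"
    by (simp add: algebra_simps power2_eq_square)
  finally show ?thesis using 1 by (simp add: algebra_simps)
qed

text \<open>A good tuple is determined by the union of its traces on the home blocks and the union of
  its traces elsewhere; goodness makes the latter small on every \<open>stall\<close>.\<close>

definition stall :: "nat set \<Rightarrow> nat set" where
  "stall S = {y \<in> {1..n}. {home y, guest y} = S}"

lemma card_good_le:
  "card good \<le> 2 ^ n * (\<Prod>S\<in>[{1..l}]\<^bsup>2\<^esup>. card {W. W \<subseteq> stall S \<and> card W \<le> m S})"
proof -
  let ?P = "[{1..l}]\<^bsup>2\<^esup>"
  let ?T = "Pow {1..n} \<times> PiE ?P (\<lambda>S. {W. W \<subseteq> stall S \<and> card W \<le> m S})"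
  define U where "U = (\<lambda>A. \<Union>k\<in>{1..l}. A k \<inter> block k :: nat set)"
  define E where "E = (\<lambda>A. \<Union>k\<in>{1..l}. A k - block k :: nat set)"
  define f where "f = (\<lambda>A. (U A, \<lambda>S\<in>?P. E A \<inter> stall S))"
  have mem: "y \<in> {1..n}" if "A \<in> good" "k \<in> {1..l}" "y \<in> A k" for A k y
    using overlapping_on_subset[OF overlap that(2) PiE_mem[of A _ F, OF _ that(2)]] that(1,3)
    unfolding good_def by blast
  have hg: "k = home y \<or> k = guest y" if "A \<in> good" "k \<in> {1..l}" "y \<in> A k" for A k y
    using that unfolding good_def by blast
  \<comment> \<open>Home blocks are disjoint, so on \<open>block k\<close> the union
    \<open>U A\<close> is just \<open>A k\<close>.\<close>
  have U: "y \<in> U A \<longleftrightarrow> y \<in> A k" if "A \<in> good" "k \<in> {1..l}" "y \<in> block k" for A k y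
    using that by (auto simp: U_def block_def)
  \<comment> \<open>By goodness a family using \<open>y\<close> away from its home is the guest, so
    \<open>E A\<close> records the guest alone.\<close>
  have E: "y \<in> E A \<longleftrightarrow> y \<in> A k"
    if "A \<in> good" "k \<in> {1..l}" "k = guest y" "y \<notin> block k" "y \<in> {1..n}" for A k y
  proof
    assume "y \<in> E A"
    then obtain x where x: "x \<in> {1..l}" "y \<in> A x" "y \<notin> block x" unfolding E_def by blast
    have "home y \<noteq> x" using x(3) that(5) by (simp add: block_def)
    then have "x = k" using hg[OF that(1) x(1,2)] that(3) by simp
    then show "y \<in> A k" using x(2) by simp
  next
    assume "y \<in> A k"
    then show "y \<in> E A" using that(2,4) unfolding E_def by blast
  qed
  \<comment> \<open>Reconstruction of a good tuple from its code: home points are read from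
    \<open>U A\<close>, guest points from the coordinate \<open>{home y, guest y}\<close>, which is
    a genuine pair there.\<close>
  have A_eq: "y \<in> A k \<longleftrightarrow> y \<in> {1..n} \<and> (if home y = k then y \<in> U A
      else guest y = k \<and> y \<in> (restrict (\<lambda>S. E A \<inter> stall S) ?P) {home y, guest y})"
    if A: "A \<in> good" "k \<in> {1..l}" for A k y
  proof (cases "y \<in> {1..n}")
    case True
    show ?thesis
    proof (cases "home y = k")
      case T: True
      then show ?thesis using U[OF A, of y] True by (simp add: block_def)
    next
      case F: False
      show ?thesis
      proof (cases "guest y = k")
        case G: True
        have "{home y, guest y} \<in> ?P" using home(1)[OF True] F G A(2) by auto
        then show ?thesis using E[OF A, of y] F G True by (simp add: block_def stall_def)
      next
        case False
        then show ?thesis using hg[OF A, of y] F by auto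
      qed
    qed
  next
    case False
    then show ?thesis using mem[OF A] by blast
  qed
  have inj: "inj_on f good"
  proof (rule inj_onI)
    fix A B assume AB: "A \<in> good" "B \<in> good" "f A = f B"
    have ext: "A \<in> extensional {1..l}" "B \<in> extensional {1..l}"
      using AB(1,2) by (auto simp: good_def PiE_def)
    show "A = B"
    proof (rule extensionalityI[OF ext])
      fix k assume k: "k \<in> {1..l}"
      show "A k = B k"
        using A_eq[OF AB(1) k] A_eq[OF AB(2) k] AB(3) unfolding f_def prod.inject
        by (intro set_eqI) simp
    qed
  qed
  \<comment> \<open>A point of \<open>E A\<close> in the stall of \<open>{i, j}\<close> lies in the
    guest's member, and the home's member absorbs it. So it lies in both enlarged members, which
    obey the overlap bound.\<close>
  have bound: "card (E A \<inter> stall S) \<le> m S" if A: "A \<in> good" and S: "S \<in> ?P" for A S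
  proof -
    obtain i j where ij: "S = {i, j}" "i \<in> {1..l}" "j \<in> {1..l}" "i \<noteq> j" using S by (auto elim: nsets2_E)
    let ?A = "A i \<union> (A j \<inter> block i)" and ?B = "A j \<union> (A i \<inter> block j)"
    have mems: "?A \<in> F i" "?B \<in> F j" using A ij unfolding good_def by blast+
    have "E A \<inter> stall S \<subseteq> ?A \<inter> ?B"
    proof
      fix y assume "y \<in> E A \<inter> stall S"
      then obtain k where y: "k \<in> {1..l}" "y \<in> A k" "y \<notin> block k" "y \<in> {1..n}" "{home y, guest y} = {i, j}"
        unfolding E_def stall_def ij(1) by blast
      have "home y \<noteq> k" using y(3,4) by (simp add: block_def)
      then have "guest y = k" using hg[OF A y(1,2)] by blast
      with \<open>home y \<noteq> k\<close> y(5) have "home y = i \<and> k = j \<or> home y = j \<and> k = i"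
        by (auto simp: doubleton_eq_iff)
      then show "y \<in> ?A \<inter> ?B" using y(2,4) unfolding block_def by blast
    qed
    then have "card (E A \<inter> stall S) \<le> card (?A \<inter> ?B)"
      using overlapping_on_finite_mem[OF overlap _ ij(2) mems(1)] by (intro card_mono) auto
    also have "\<dots> \<le> m S" unfolding ij(1) by (rule overlapping_onD[OF overlap ij(2-4) mems])
    finally show ?thesis .
  qed
  have sub: "f ` good \<subseteq> ?T"
  proof
    fix x assume "x \<in> f ` good"
    then obtain A where A: "A \<in> good" "x = f A" by blast
    have "U A \<in> Pow {1..n}" unfolding U_def block_def by blast
    moreover have "(\<lambda>S\<in>?P. E A \<inter> stall S) \<in> PiE ?P (\<lambda>S. {W. W \<subseteq> stall S \<and> card W \<le> m S})"
      using bound[OF A(1)] by (intro restrict_PiE_iff[THEN iffD2]) blast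
    ultimately show "x \<in> ?T" unfolding A(2) f_def by (rule SigmaI)
  qed
  have finT: "finite ?T"
    by (intro finite_cartesian_product finite_PiE finite_pairs)
      (auto simp: stall_def intro: finite_subset[of _ "Pow {1..n}"])
  have "card good = card (f ` good)" by (rule card_image[OF inj, symmetric])
  also have "\<dots> \<le> card ?T" by (rule card_mono[OF finT sub])
  also have "\<dots> = 2 ^ n * (\<Prod>S\<in>?P. card {W. W \<subseteq> stall S \<and> card W \<le> m S})"
    by (simp add: card_cartesian_product card_Pow card_PiE finite_pairs[simplified])
  finally show ?thesis .
qed

lemma sum_card_stall: "(\<Sum>S\<in>[{1..l}]\<^bsup>2\<^esup>. card (stall S)) \<le> n"
proof -
  have "(\<Sum>S\<in>[{1..l}]\<^bsup>2\<^esup>. card (stall S)) = card (\<Union>S\<in>[{1..l}]\<^bsup>2\<^esup>. stall S)"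
    by (rule card_UN_disjoint[symmetric]) (auto simp: finite_pairs[simplified] stall_def)
  also have "\<dots> \<le> card {1..n}" by (intro card_mono) (auto simp: stall_def)
  finally show ?thesis by simp
qed

end

section \<open>The block construction\<close>

text \<open>On disjoint ground sets the parts of a union do not interact: overlaps add, and the
  parts are recovered as traces, so sizes multiply.\<close>

lemma overlapping_on_join:
  assumes F: "overlapping_on V l m1 F" and G: "overlapping_on W l m2 G"
    and disj: "V \<inter> W = {}"
  defines "H \<equiv> \<lambda>k. (\<lambda>(A, B). A \<union> B) ` (F k \<times> G k)"
  shows "overlapping_on (V \<union> W) l (\<lambda>S. m1 S + m2 S) H"
    and "k \<in> {1..l} \<Longrightarrow> card (H k) = card (F k) * card (G k)"
proof -
  have memE: thesis
    if "X \<in> H k" "\<And>A B. X = A \<union> B \<Longrightarrow> A \<in> F k \<Longrightarrow> B \<in> G k \<Longrightarrow> thesis" for X k thesis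
    using that(1) unfolding H_def by (elim imageE SigmaE) (simp add: that(2))
  show "overlapping_on (V \<union> W) l (\<lambda>S. m1 S + m2 S) H"
    unfolding overlapping_on_def overlapping_def
  proof (intro conjI ballI impI)
    fix k assume k: "k \<in> {1..l}"
    show "H k \<subseteq> Pow (V \<union> W)"
    proof
      fix A assume "A \<in> H k"
      then obtain B C where A: "A = B \<union> C" "B \<in> F k" "C \<in> G k" by (rule memE)
      show "A \<in> Pow (V \<union> W)"
        unfolding A(1) using overlapping_on_subset[OF F k A(2)] overlapping_on_subset[OF G k A(3)] by simp blast
    qed
  next
    fix i j A B assume ij: "i \<in> {1..l}" "j \<in> {1..l}" "i \<noteq> j" and AB: "A \<in> H i" "B \<in> H j"
    obtain A1 A2 where A: "A = A1 \<union> A2" "A1 \<in> F i" "A2 \<in> G i" using AB(1) by (rule memE)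
    obtain B1 B2 where B: "B = B1 \<union> B2" "B1 \<in> F j" "B2 \<in> G j" using AB(2) by (rule memE)
    have "A1 \<subseteq> V" "A2 \<subseteq> W" "B1 \<subseteq> V" "B2 \<subseteq> W"
      by (rule overlapping_on_subset[OF F ij(1) A(2)] overlapping_on_subset[OF G ij(1) A(3)]
          overlapping_on_subset[OF F ij(2) B(2)] overlapping_on_subset[OF G ij(2) B(3)])+
    then have "A \<inter> B = (A1 \<inter> B1) \<union> (A2 \<inter> B2)" unfolding A(1) B(1) using disj by blast
    then have "card (A \<inter> B) \<le> card (A1 \<inter> B1) + card (A2 \<inter> B2)" by (simp only: card_Un_le)
    also have "\<dots> \<le> m1 {i, j} + m2 {i, j}"
      by (rule add_mono[OF overlapping_onD[OF F ij A(2) B(2)] overlapping_onD[OF G ij A(3) B(3)]])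
    finally show "card (A \<inter> B) \<le> m1 {i, j} + m2 {i, j}" .
  qed
next
  assume k: "k \<in> {1..l}"
  have "inj_on (\<lambda>(A, B). A \<union> B) (F k \<times> G k)"
  proof (rule inj_onI)
    fix x y assume xy: "x \<in> F k \<times> G k" "y \<in> F k \<times> G k" and eq: "(\<lambda>(A, B). A \<union> B) x = (\<lambda>(A, B). A \<union> B) y"
    obtain A B where x: "x = (A, B)" by (cases x)
    obtain A' B' where y: "y = (A', B')" by (cases y)
    have mem: "A \<in> F k" "B \<in> G k" "A' \<in> F k" "B' \<in> G k" using xy unfolding x y by blast+
    have "A \<subseteq> V" "B \<subseteq> W" "A' \<subseteq> V" "B' \<subseteq> W"
      by (rule overlapping_on_subset[OF F k mem(1)] overlapping_on_subset[OF G k mem(2)]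
          overlapping_on_subset[OF F k mem(3)] overlapping_on_subset[OF G k mem(4)])+
    moreover have "A \<union> B = A' \<union> B'" using eq unfolding x y by simp
    ultimately have "A = A'" "B = B'" using disj by blast+
    then show "x = y" unfolding x y by simp
  qed
  then have "card (H k) = card (F k \<times> G k)" unfolding H_def by (rule card_image)
  then show "card (H k) = card (F k) * card (G k)" by (simp only: card_cartesian_product)
qed

lemma overlapping_on_pair:
  assumes "i \<in> {1..l}" "j \<in> {1..l}" "i \<noteq> j" "finite W"
  obtains G where "overlapping_on W l (\<lambda>T. if T = {i, j} then c else 0) G"
    "(\<Prod>k\<in>{1..l}. card (G k)) = 2 ^ card W * (card W choose c)"
proof
  define G where "G = (\<lambda>k. if k = i then Pow W else if k = j then {A. A \<subseteq> W \<and> card A = c} else {{}})"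
  show "overlapping_on W l (\<lambda>T. if T = {i, j} then c else 0) G"
    unfolding overlapping_on_def overlapping_def
  proof (intro conjI ballI impI)
    fix k show "G k \<subseteq> Pow W" unfolding G_def by auto
  next
    fix a b A B assume ab: "a \<noteq> b" "A \<in> G a" "B \<in> G b"
    show "card (A \<inter> B) \<le> (if {a, b} = {i, j} then c else 0)"
    proof (cases "{a, b} = {i, j}")
      case True
      then have "a = i \<and> b = j \<or> a = j \<and> b = i" by (auto simp: doubleton_eq_iff)
      moreover have "card X = c \<and> finite X" if "X \<in> G j" for X
        using that assms(3) finite_subset[of X W] assms(4) by (simp add: G_def)
      ultimately have "card A = c \<and> finite A \<or> card B = c \<and> finite B"
        using ab(2,3) by blast
      then have "card (A \<inter> B) \<le> c" by (metis Int_lower1 Int_lower2 card_mono)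
      then show ?thesis using True by simp
    next
      case False
      then have "A = {} \<or> B = {}" using ab by (auto simp: G_def split: if_splits)
      then show ?thesis by auto
    qed
  qed
  have "(\<Prod>k\<in>{1..l}. card (G k)) = (\<Prod>k\<in>{i, j}. card (G k))"
    by (rule prod.mono_neutral_right) (use assms in \<open>auto simp: G_def\<close>)
  also have "\<dots> = 2 ^ card W * (card W choose c)"
    using assms(3,4) by (simp add: G_def card_Pow n_subsets)
  finally show "(\<Prod>k\<in>{1..l}. card (G k)) = 2 ^ card W * (card W choose c)" .
qed

text \<open>Each pair cuts a block of size \<open>a S\<close> out of the ground set, and the tuples
  on the blocks are joined; every block contributes its full power of 2.\<close>

lemma overlapping_on_blocks:
  assumes "finite \<S>" "\<S> \<subseteq> [{1..l}]\<^bsup>2\<^esup>" "l > 0" "finite V" "sum a \<S> \<le> card V"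
  shows "\<exists>F. overlapping_on V l (\<lambda>T. if T \<in> \<S> then m T else 0) F \<and>
    (\<Prod>k\<in>{1..l}. card (F k)) = 2 ^ card V * (\<Prod>S\<in>\<S>. a S choose m S)"
  using assms(1,2,4,5)
proof (induction \<S> arbitrary: V rule: finite_induct)
  case empty
  \<comment> \<open>The points left over by all blocks go to family 1, so that no power of 2 is
    lost.\<close>
  define F where "F = (\<lambda>k::nat. if k = 1 then Pow V else {{}})"
  have "overlapping_on V l (\<lambda>T. 0) F"
    unfolding overlapping_on_def overlapping_def
  proof (intro conjI ballI impI)
    fix k show "F k \<subseteq> Pow V" unfolding F_def by auto
  next
    fix a b A B assume "a \<noteq> b" "A \<in> F a" "B \<in> F b"
    then have "A = {} \<or> B = {}" by (auto simp: F_def split: if_splits)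
    then show "card (A \<inter> B) \<le> 0" by auto
  qed
  moreover have "(\<Prod>k\<in>{1..l}. card (F k)) = (\<Prod>k\<in>{1}. card (F k))"
    by (rule prod.mono_neutral_right) (use assms(3) in \<open>auto simp: F_def\<close>)
  moreover have "(\<Prod>k\<in>{1}. card (F k)) = 2 ^ card V" using empty by (simp add: F_def card_Pow)
  ultimately show ?case by auto
next
  case (insert S \<S>)
  have "a S \<le> card V" using insert.prems(3) insert.hyps by simp
  then obtain W where W: "W \<subseteq> V" "card W = a S" "finite W" by (rule obtain_subset_with_card_n)
  have cardVW: "card (V - W) = card V - a S" using W by (simp add: card_Diff_subset)
  have fin: "finite (V - W)" using insert.prems(2) by simp
  have "sum a \<S> \<le> card (V - W)" using cardVW insert.prems(3) insert.hyps by simp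
  with insert.IH[OF _ fin this] insert.prems(1) obtain F where
    F: "overlapping_on (V - W) l (\<lambda>T. if T \<in> \<S> then m T else 0) F"
    "(\<Prod>k\<in>{1..l}. card (F k)) = 2 ^ card (V - W) * (\<Prod>S\<in>\<S>. a S choose m S)"
    by blast
  obtain i j where ij: "S = {i, j}" "i \<in> {1..l}" "j \<in> {1..l}" "i \<noteq> j"
    using insert.prems(1) by (auto elim: nsets2_E)
  obtain G where G: "overlapping_on W l (\<lambda>T. if T = S then m S else 0) G"
    "(\<Prod>k\<in>{1..l}. card (G k)) = 2 ^ card W * (card W choose m S)"
    using overlapping_on_pair[OF ij(2-4) W(3), where c = "m S"] unfolding ij(1) by blast
  let ?H = "\<lambda>k. (\<lambda>(A, B). A \<union> B) ` (F k \<times> G k)"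
  note join = overlapping_on_join[OF F(1) G(1)]
  have VW: "V - W \<union> W = V" "(V - W) \<inter> W = {}" using W(1) by auto
  have "(\<lambda>T. (if T \<in> \<S> then m T else 0) + (if T = S then m S else 0))
      = (\<lambda>T. if T \<in> insert S \<S> then m T else 0)"
    using insert.hyps(2) by auto
  then have 1: "overlapping_on V l (\<lambda>T. if T \<in> insert S \<S> then m T else 0) ?H"
    using join(1)[OF VW(2)] VW(1) by simp
  have "(\<Prod>k\<in>{1..l}. card (?H k)) = (\<Prod>k\<in>{1..l}. card (F k) * card (G k))"
    by (rule prod.cong[OF refl join(2)[OF VW(2)]])
  also have "\<dots> = (2 ^ card (V - W) * 2 ^ card W) * (\<Prod>S\<in>insert S \<S>. a S choose m S)"
    using F(2) G(2) W(2) insert.hyps by (simp add: prod.distrib)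
  also have "2 ^ card (V - W) * 2 ^ card W = (2::nat) ^ card V"
    using cardVW W(2) \<open>a S \<le> card V\<close> by (simp flip: power_add)
  finally show ?case using 1 by blast
qed

lemma s_star_ge:
  assumes "l > 0" "sum a ([{1..l}]\<^bsup>2\<^esup>) \<le> n"
  shows "2 ^ n * (\<Prod>S\<in>[{1..l}]\<^bsup>2\<^esup>. a S choose m S) \<le> s_star n l m"
proof -
  obtain F where F: "overlapping_on {1..n} l (\<lambda>T. if T \<in> [{1..l}]\<^bsup>2\<^esup> then m T else 0) F"
    "(\<Prod>k\<in>{1..l}. card (F k)) = 2 ^ card {1..n} * (\<Prod>S\<in>[{1..l}]\<^bsup>2\<^esup>. a S choose m S)"
    using overlapping_on_blocks[OF finite_pairs order_refl assms(1), of "{1..n}" a m] assms(2) by auto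
  have "overlapping_on {1..n} l m F"
    using F(1) unfolding overlapping_on_def overlapping_def by simp
  from prod_card_le_s_star[OF this] show ?thesis using F(2) by simp
qed

section \<open>Binomial and AM-GM estimates\<close>

lemma power_le_fact_times_binomial: "(Suc a - k) ^ k \<le> fact k * (a choose k)"
proof (induction k)
  \<comment> \<open>\<open>fact k * (a choose k)\<close> is a falling factorial whose last factor is
    \<open>Suc a - k\<close>; the step appends the smaller factor \<open>a - k\<close>.\<close>
  case (Suc k)
  have "(Suc a - Suc k) ^ Suc k \<le> (a - k) * (Suc a - k) ^ k"
    by (simp add: mult_left_mono power_mono)
  also have "\<dots> \<le> (a - k) * (fact k * (a choose k))" by (rule mult_left_mono[OF Suc]) simp
  also have "\<dots> = fact k * ((a - k) * (a choose k))" by (simp only: mult.left_commute)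
  also have "(a - k) * (a choose k) = Suc k * (a choose Suc k)"
    by (simp only: binomial_absorb_comp binomial_absorption)
  also have "fact k * \<dots> = fact (Suc k) * (a choose Suc k)" by (simp add: algebra_simps)
  finally show ?case .
qed simp

text \<open>Bernoulli's inequality for \<open>(x - k) ^ k = x ^ k * (1 - k / x) ^ k\<close>. The
  slack \<open>x \<le> real a + 1\<close> allows \<open>a\<close> to be \<open>x\<close> rounded
  down.\<close>

lemma binomial_ge_power:
  fixes x :: real
  assumes "x \<ge> 0" "x \<le> real a + 1" "real k \<le> x"
  shows "x ^ k / fact k - x ^ k / fact k * (real k ^ 2 / x) \<le> real (a choose k)"
proof (cases "x = 0")
  case True
  then show ?thesis using assms(3) by simp
next
  case False
  then have x: "x > 0" using assms(1) by simp
  have "x ^ k * (1 + real k * (- real k / x)) \<le> x ^ k * (1 + (- real k / x)) ^ k"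
    using assms x by (intro mult_left_mono Bernoulli_inequality) (auto simp: field_simps)
  also have "\<dots> = (x * (1 + (- real k / x))) ^ k" by (simp add: power_mult_distrib)
  also have "x * (1 + (- real k / x)) = x - k" using x by (simp add: field_simps)
  also have "(x - k) ^ k \<le> real (Suc a - k) ^ k"
    using assms by (intro power_mono) linarith+
  also have "\<dots> \<le> real (fact k * (a choose k))"
    using power_le_fact_times_binomial[of a k] by (simp only: of_nat_le_iff flip: of_nat_power)
  finally have "x ^ k * (1 + real k * (- real k / x)) \<le> fact k * real (a choose k)" by simp
  then have "x ^ k * (1 + real k * (- real k / x)) / fact k \<le> real (a choose k)"
    by (simp add: pos_divide_le_eq mult.commute)
  also have "x ^ k * (1 + real k * (- real k / x)) / fact k
      = x ^ k / fact k - x ^ k / fact k * (real k ^ 2 / x)"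
    by (simp add: diff_divide_distrib right_diff_distrib power2_eq_square)
  finally show ?thesis .
qed

text \<open>Weighting the subsets of size \<open>i\<close> by \<open>k choose (k - i)\<close>, which
  is at least 1, turns the count into a Vandermonde sum.\<close>

lemma card_small_subsets_le:
  assumes "finite Y"
  shows "real (card {W. W \<subseteq> Y \<and> card W \<le> k}) \<le> (real (card Y) + k) ^ k / fact k"
proof -
  have "{W. W \<subseteq> Y \<and> card W \<le> k} = (\<Union>i\<le>k. {W. W \<subseteq> Y \<and> card W = i})" by auto
  then have "card {W. W \<subseteq> Y \<and> card W \<le> k} \<le> (\<Sum>i\<le>k. card {W. W \<subseteq> Y \<and> card W = i})"
    by (simp add: card_UN_le)
  also have "\<dots> = (\<Sum>i\<le>k. card Y choose i)" using assms by (simp add: n_subsets)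
  also have "\<dots> \<le> (\<Sum>i\<le>k. (card Y choose i) * (k choose (k - i)))"
    by (rule sum_mono) (simp add: Suc_le_eq)
  also have "\<dots> = (card Y + k) choose k" by (rule vandermonde)
  finally have "card {W. W \<subseteq> Y \<and> card W \<le> k} * fact k \<le> ((card Y + k) choose k) * fact k" by simp
  also have "\<dots> \<le> (card Y + k) ^ k" by (rule binomial_fact_pow)
  finally have "real (card {W. W \<subseteq> Y \<and> card W \<le> k} * fact k) \<le> real ((card Y + k) ^ k)"
    by (simp only: of_nat_le_iff)
  then show ?thesis by (simp add: pos_le_divide_eq)
qed

text \<open>Weighted AM-GM by way of \<open>t \<le> exp (t - 1)\<close>, applied to each
  \<open>z S\<close> relative to its optimal value; the exponents then sum to at most 0.\<close>

lemma prod_power_le_AM_GM: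
  fixes z :: "'a \<Rightarrow> real" and m :: "'a \<Rightarrow> nat"
  assumes "finite P" "\<And>S. S \<in> P \<Longrightarrow> z S \<ge> 0" "(\<Sum>S\<in>P. z S) \<le> Z" "Z > 0"
  defines "M \<equiv> (\<Sum>S\<in>P. real (m S))"
  shows "(\<Prod>S\<in>P. z S ^ m S) \<le> (\<Prod>S\<in>P. (real (m S) * Z / M) ^ m S)"
proof -
  have M: "M \<ge> 0" unfolding M_def by (rule sum_nonneg) simp
  have le: "z S ^ m S \<le> (real (m S) * Z / M) ^ m S * exp (z S * M / Z - m S)" if S: "S \<in> P" for S
  proof (cases "m S = 0")
    case True
    then show ?thesis using M assms(4) assms(2)[OF S] by simp
  next
    case False
    have "real (m S) \<le> M" unfolding M_def by (rule member_le_sum[OF S _ assms(1)]) simp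
    then have Mp: "M > 0" using False by simp
    \<comment> \<open>The value of \<open>z S\<close> at which the product is largest under the sum
      constraint.\<close>
    define c where "c = real (m S) * Z / M"
    have c: "c > 0" using Mp assms(4) False by (simp add: c_def)
    have "z S / c \<le> exp (z S / c - 1)" using exp_ge_add_one_self[of "z S / c - 1"] by simp
    then have "z S \<le> c * exp (z S / c - 1)" using c by (simp add: field_simps)
    then have "z S ^ m S \<le> (c * exp (z S / c - 1)) ^ m S" by (rule power_mono) (rule assms(2)[OF S])
    also have "\<dots> = c ^ m S * exp (real (m S) * (z S / c - 1))"
      by (simp add: power_mult_distrib exp_of_nat_mult)
    also have "real (m S) * (z S / c - 1) = z S * M / Z - m S"
      using Mp assms(4) False by (simp add: c_def field_simps)
    finally show ?thesis by (simp add: c_def)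
  qed
  have "(\<Prod>S\<in>P. z S ^ m S) \<le> (\<Prod>S\<in>P. (real (m S) * Z / M) ^ m S * exp (z S * M / Z - m S))"
    using le assms(2) by (intro prod_mono) simp
  also have "\<dots> = (\<Prod>S\<in>P. (real (m S) * Z / M) ^ m S) * exp (\<Sum>S\<in>P. z S * M / Z - m S)"
    by (simp add: prod.distrib exp_sum assms(1))
  also have "\<dots> \<le> (\<Prod>S\<in>P. (real (m S) * Z / M) ^ m S) * 1"
  proof (rule mult_left_mono)
    have "(\<Sum>S\<in>P. z S * M / Z - m S) = (\<Sum>S\<in>P. z S * (M / Z)) - M"
      unfolding M_def by (simp only: sum_subtractf times_divide_eq_right)
    also have "(\<Sum>S\<in>P. z S * (M / Z)) = (\<Sum>S\<in>P. z S) * (M / Z)"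
      by (rule sum_distrib_right[symmetric])
    also have "(\<Sum>S\<in>P. z S) * (M / Z) - M \<le> Z * (M / Z) - M" using M assms(3,4) by (intro diff_right_mono mult_right_mono) auto
    also have "\<dots> = 0" using assms(4) by simp
    finally show "exp (\<Sum>S\<in>P. z S * M / Z - m S) \<le> 1" by simp
    show "0 \<le> (\<Prod>S\<in>P. (real (m S) * Z / M) ^ m S)"
      using M assms(4) by (intro prod_nonneg zero_le_power) simp
  qed
  finally show ?thesis by simp
qed

text \<open>Convexity on the unit interval: the right-hand side is the chord from
  \<open>t = 0\<close> to \<open>t = 1\<close>.\<close>

lemma power_one_add_le:
  fixes a t :: real
  assumes "a \<ge> 0" "0 \<le> t" "t \<le> 1"
  shows "(1 + a * t) ^ k \<le> 1 + ((1 + a) ^ k - 1) * t"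
proof (induction k)
  case (Suc k)
  define b where "b = (1 + a) ^ k - 1"
  have b: "b \<ge> 0" using one_le_power[of "1 + a" k] assms(1) by (simp add: b_def)
  have "(1 + a * t) ^ Suc k \<le> (1 + a * t) * (1 + b * t)"
    using Suc assms by (simp add: b_def mult_left_mono)
  also have "\<dots> = 1 + (a + b) * t + (a * b) * (t * t)" by (simp add: algebra_simps)
  also have "\<dots> \<le> 1 + (a + b) * t + (a * b) * t"
    using assms b mult_left_le_one_le[of t t] by (intro add_left_mono mult_left_mono) auto
  also have "\<dots> = 1 + ((1 + a) ^ Suc k - 1) * t" by (simp add: b_def algebra_simps)
  finally show ?case .
qed simp

section \<open>Asymptotics\<close>

text \<open>The real argument permits evaluation at shifted values such as \<open>n + M\<close>.
  Factors with \<open>m S = 0\<close> are \<open>0 ^ 0 = 1\<close>, even when the denominator is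
  0.\<close>

definition leading_term :: "nat \<Rightarrow> (nat set \<Rightarrow> nat) \<Rightarrow> real \<Rightarrow> real" where
  "leading_term l m x = (\<Prod>S\<in>[{1..l}]\<^bsup>2\<^esup>.
     1 / fact (m S) * (real (m S) * x / (\<Sum>S'\<in>[{1..l}]\<^bsup>2\<^esup>. real (m S'))) ^ m S)"

lemma weight_pos:
  fixes l :: nat
  assumes "S \<in> [{1..l}]\<^bsup>2\<^esup>" "m S > 0"
  shows "(\<Sum>S'\<in>[{1..l}]\<^bsup>2\<^esup>. real (m S')) > 0"
  by (rule sum_pos2[OF finite_pairs assms(1)]) (use assms(2) in auto)

lemma leading_term_pos:
  assumes "x > 0"
  shows "leading_term l m x > 0"
  unfolding leading_term_def
proof (rule prod_pos)
  fix S assume S: "S \<in> [{1..l}]\<^bsup>2\<^esup>"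
  show "0 < 1 / fact (m S) * (real (m S) * x / (\<Sum>S'\<in>[{1..l}]\<^bsup>2\<^esup>. real (m S'))) ^ m S"
  proof (cases "m S = 0")
    case False
    then show ?thesis using weight_pos[OF S] assms by simp
  qed simp
qed

lemma leading_term_mult:
  "leading_term l m (x * y) = leading_term l m x * y ^ (\<Sum>S\<in>[{1..l}]\<^bsup>2\<^esup>. m S)"
proof -
  have "leading_term l m (x * y) = (\<Prod>S\<in>[{1..l}]\<^bsup>2\<^esup>.
     (1 / fact (m S) * (real (m S) * x / (\<Sum>S'\<in>[{1..l}]\<^bsup>2\<^esup>. real (m S'))) ^ m S) * y ^ m S)"
    unfolding leading_term_def
    by (rule prod.cong) (simp_all add: power_mult_distrib power_divide)
  then show ?thesis by (simp only: prod.distrib leading_term_def power_sum)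
qed

text \<open>The block construction with the optimal real block sizes rounded down. Only
  \<open>M ^ 2 \<le> n\<close> needs work, since otherwise the left side is not positive.\<close>

lemma s_star_ge_leading:
  fixes m :: "nat set \<Rightarrow> nat"
  assumes "l > 0" "n > 0"
  defines "M \<equiv> \<Sum>S\<in>[{1..l}]\<^bsup>2\<^esup>. real (m S)"
  shows "2 ^ n * leading_term l m n * (1 - M ^ 2 / n) \<le> s_star n l m"
proof (cases "M ^ 2 \<le> n")
  case False
  then have "1 - M ^ 2 / n \<le> 0" using assms(2) by simp
  then have "2 ^ n * leading_term l m n * (1 - M ^ 2 / n) \<le> 0"
    using leading_term_pos[of n l m] assms(2) by (intro mult_nonneg_nonpos) auto
  then show ?thesis by linarith
next
  case True
  let ?P = "[{1..l}]\<^bsup>2\<^esup>"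
  have M: "M \<ge> 0" unfolding M_def by (rule sum_nonneg) simp
  have mM: "real (m S) \<le> M" if "S \<in> ?P" for S
    unfolding M_def by (rule member_le_sum[OF that _ finite_pairs]) simp
  define x where "x = (\<lambda>S. real (m S) * n / M)"
  define a where "a = (\<lambda>S. nat \<lfloor>x S\<rfloor>)"
  have x: "x S \<ge> 0" for S using M by (simp add: x_def)
  have a: "real (a S) \<le> x S" "x S \<le> real (a S) + 1" for S using x[of S] by (simp_all add: a_def)
  have "(\<Sum>S\<in>?P. x S) = (\<Sum>S\<in>?P. real (m S)) * n / M"
    by (simp only: x_def sum_distrib_right sum_divide_distrib)
  also have "\<dots> = M * n / M" by (simp only: M_def)
  also have "\<dots> \<le> n" by (cases "M = 0") simp_all
  finally have "(\<Sum>S\<in>?P. real (a S)) \<le> n" using sum_mono[of ?P "\<lambda>S. real (a S)" x] a(1) by force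
  then have "sum a ?P \<le> n" by (simp only: of_nat_le_iff flip: of_nat_sum)
  from of_nat_mono[OF s_star_ge[OF assms(1) this, of m], where 'a = real]
  have ge: "2 ^ n * (\<Prod>S\<in>?P. real (a S choose m S)) \<le> s_star n l m" by simp
  define t where "t = (\<lambda>S. 1 / fact (m S) * x S ^ m S)"
  \<comment> \<open>The relative loss \<open>m S ^ 2 / x S\<close> of
    \<open>binomial_ge_power\<close>; these losses sum to \<open>M ^ 2 / n\<close>.\<close>
  define u where "u = (\<lambda>S. real (m S) * M / n)"
  have t: "t S \<ge> 0" for S using x[of S] by (simp add: t_def)
  have u: "0 \<le> u S" "u S \<le> 1" if "S \<in> ?P" for S
  proof -
    show "0 \<le> u S" using M by (simp add: u_def)
    have "real (m S) * M \<le> M * M" using mM[OF that] M by (rule mult_right_mono)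
    also have "\<dots> \<le> n" using True by (simp add: power2_eq_square)
    finally show "u S \<le> 1" using assms(2) by (simp add: u_def)
  qed
  have le: "t S * (1 - u S) \<le> real (a S choose m S)" if S: "S \<in> ?P" for S
  proof (cases "m S = 0")
    case True
    then show ?thesis by (simp add: t_def u_def)
  next
    case False
    then have mp: "real (m S) \<ge> 1" "M > 0" using mM[OF S] by linarith+
    have "real (m S) * M \<le> n" using u(2)[OF S] assms(2) by (simp add: u_def)
    moreover have "1 * M \<le> real (m S) * M" using mp by (intro mult_right_mono) auto
    ultimately have "M \<le> real n" by linarith
    then have "real (m S) * 1 \<le> real (m S) * (n / M)" using mp by (intro mult_left_mono) auto
    then have "real (m S) \<le> x S" by (simp add: x_def)
    from binomial_ge_power[OF x a(2) this]
    have "x S ^ m S / fact (m S) - x S ^ m S / fact (m S) * (real (m S) ^ 2 / x S) \<le> real (a S choose m S)" .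
    also have "real (m S) ^ 2 / x S = u S"
      using mp assms(2) by (simp add: x_def u_def power2_eq_square field_simps)
    finally show ?thesis by (simp add: t_def right_diff_distrib)
  qed
  have "(\<Sum>S\<in>?P. u S) = M ^ 2 / n"
    by (simp add: u_def M_def power2_eq_square flip: sum_distrib_right sum_divide_distrib)
  then have "1 - M ^ 2 / n \<le> (\<Prod>S\<in>?P. 1 - u S)"
    using Weierstrass_prod_ineq[of ?P u] u by simp
  then have "leading_term l m n * (1 - M ^ 2 / n) \<le> leading_term l m n * (\<Prod>S\<in>?P. 1 - u S)"
    using leading_term_pos[of n l m] assms(2) by (intro mult_left_mono) auto
  also have "\<dots> = (\<Prod>S\<in>?P. t S * (1 - u S))"
    by (simp only: prod.distrib leading_term_def t_def x_def M_def)
  also have "\<dots> \<le> (\<Prod>S\<in>?P. real (a S choose m S))"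
    using le t u by (intro prod_mono) auto
  finally have "2 ^ n * (leading_term l m n * (1 - M ^ 2 / n)) \<le> 2 ^ n * (\<Prod>S\<in>?P. real (a S choose m S))"
    by (rule mult_left_mono) simp
  from order_trans[OF this ge] show ?thesis by (simp only: mult.assoc)
qed

text \<open>The padded sizes \<open>card (Y S) + m S\<close> sum to at most \<open>n + M\<close>, so
  AM-GM gives the leading term at \<open>n + M\<close>; homogeneity extracts the correction
  factor.\<close>

lemma prod_small_subsets_le_leading:
  fixes m :: "nat set \<Rightarrow> nat"
  assumes "n > 0" "\<And>S. finite (Y S)" "(\<Sum>S\<in>[{1..l}]\<^bsup>2\<^esup>. card (Y S)) \<le> n"
  defines "M \<equiv> \<Sum>S\<in>[{1..l}]\<^bsup>2\<^esup>. m S"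
  shows "(\<Prod>S\<in>[{1..l}]\<^bsup>2\<^esup>. real (card {W. W \<subseteq> Y S \<and> card W \<le> m S}))
    \<le> leading_term l m n * (1 + real M / n) ^ M"
proof -
  let ?P = "[{1..l}]\<^bsup>2\<^esup>"
  have sum: "(\<Sum>S\<in>?P. real (card (Y S)) + m S) \<le> real n + M"
    using assms(3) by (simp add: sum.distrib M_def flip: of_nat_sum)
  have "(\<Prod>S\<in>?P. real (card {W. W \<subseteq> Y S \<and> card W \<le> m S}))
      \<le> (\<Prod>S\<in>?P. (real (card (Y S)) + m S) ^ m S / fact (m S))"
    by (intro prod_mono conjI card_small_subsets_le assms(2)) simp
  also have "\<dots> = (\<Prod>S\<in>?P. 1 / fact (m S)) * (\<Prod>S\<in>?P. (real (card (Y S)) + m S) ^ m S)"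
    by (simp flip: prod.distrib)
  also have "\<dots> \<le> (\<Prod>S\<in>?P. 1 / fact (m S)) *
      (\<Prod>S\<in>?P. (real (m S) * (real n + M) / (\<Sum>S'\<in>?P. real (m S'))) ^ m S)"
    by (intro mult_left_mono prod_power_le_AM_GM finite_pairs sum prod_nonneg)
      (use assms(1) in simp_all)
  also have "\<dots> = leading_term l m (real n + M)" by (simp only: leading_term_def prod.distrib)
  also have "real n + M = real n * (1 + real M / n)" using assms(1) by (simp add: field_simps)
  finally show ?thesis by (simp only: leading_term_mult M_def)
qed

text \<open>The upper bound of order \<open>2 ^ n * n ^ (M - t)\<close> for \<open>m'\<close> is
  divided by the lower bound of order \<open>2 ^ n * n ^ M\<close> for \<open>m\<close>.\<close>

lemma s_star_ratio:
  assumes "l > 0"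
  shows "\<exists>D\<ge>0. \<forall>\<^sub>F n in sequentially. \<forall>m'. (\<Sum>S\<in>[{1..l}]\<^bsup>2\<^esup>. m' S) + t = (\<Sum>S\<in>[{1..l}]\<^bsup>2\<^esup>. m S) \<longrightarrow>
    real (s_star n l m') \<le> D / real n ^ t * s_star n l m"
proof -
  define M where "M = (\<Sum>S\<in>[{1..l}]\<^bsup>2\<^esup>. m S)"
  obtain C where C: "C \<ge> 0" "\<And>m' n. (\<Sum>S\<in>[{1..l}]\<^bsup>2\<^esup>. m' S) = M - t \<Longrightarrow>
      real (s_star n l m') \<le> C * 2 ^ n * (real n + 1) ^ (M - t)"
    using s_star_upper_bound[OF assms, of "M - t"] by blast
  define \<kappa> where "\<kappa> = leading_term l m 1"
  have \<kappa>: "\<kappa> > 0" unfolding \<kappa>_def by (rule leading_term_pos) simp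
  \<comment> \<open>\<open>2 ^ (M - t)\<close> comes from \<open>n + 1 \<le> 2 * n\<close>, and
    \<open>2 / \<kappa>\<close> from the lower bound, of which half is kept once
    \<open>n \<ge> 2 * M ^ 2 + 1\<close>.\<close>
  define D where "D = C * 2 ^ (M - t) * 2 / \<kappa>"
  have D: "D \<ge> 0" using C(1) \<kappa> by (simp add: D_def)
  have "real (s_star n l m') \<le> D / real n ^ t * s_star n l m"
    if n: "n \<ge> 2 * M ^ 2 + 1" and m': "(\<Sum>S\<in>[{1..l}]\<^bsup>2\<^esup>. m' S) + t = M" for n m'
  proof -
    have n0: "n > 0" "real n \<ge> 1" using n by simp_all
    have M: "(\<Sum>S\<in>[{1..l}]\<^bsup>2\<^esup>. real (m S)) = real M" by (simp add: M_def)
    have "real (2 * M ^ 2) \<le> real n" using n by linarith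
    then have "1/2 \<le> 1 - real M ^ 2 / n" using n0 by (simp add: field_simps)
    moreover have L: "leading_term l m n = \<kappa> * real n ^ M"
      using leading_term_mult[of l m 1 n] by (simp add: \<kappa>_def M_def)
    ultimately have "2 ^ n * (\<kappa> * real n ^ M) * (1/2) \<le> 2 ^ n * leading_term l m n * (1 - real M ^ 2 / n)"
      unfolding L using \<kappa> by (intro mult_left_mono) auto
    also have "\<dots> \<le> s_star n l m" using s_star_ge_leading[OF assms n0(1), of m] M by simp
    finally have lower: "2 ^ n * \<kappa> * real n ^ M / 2 \<le> s_star n l m" by simp
    have "real (s_star n l m') \<le> C * 2 ^ n * (real n + 1) ^ (M - t)"
      by (rule C(2)) (use m' in simp)
    also have "\<dots> \<le> C * 2 ^ n * (2 * real n) ^ (M - t)"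
      using C(1) n0 by (intro mult_left_mono power_mono) auto
    also have "\<dots> = D / real n ^ t * (2 ^ n * \<kappa> * real n ^ M / 2)"
    proof -
      have "real n ^ M = real n ^ (M - t) * real n ^ t" using m' by (simp flip: power_add)
      then show ?thesis using n0 \<kappa> by (simp add: D_def power_mult_distrib)
    qed
    also have "\<dots> \<le> D / real n ^ t * s_star n l m"
      using D by (intro mult_left_mono lower) simp
    finally show ?thesis .
  qed
  then have "\<forall>\<^sub>F n in sequentially. \<forall>m'. (\<Sum>S\<in>[{1..l}]\<^bsup>2\<^esup>. m' S) + t = M \<longrightarrow>
      real (s_star n l m') \<le> D / real n ^ t * s_star n l m"
    unfolding eventually_sequentially by blast
  then show ?thesis using D unfolding M_def by blast
qed

text \<open>A triple contains three pairs, and positivity of their bounds rules out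
  truncation.\<close>

lemma sum_lower_on_triple:
  assumes "K \<in> [{1..l}]\<^bsup>3\<^esup>" "\<And>S. S \<in> [K]\<^bsup>2\<^esup> \<Longrightarrow> m S > 0"
  shows "(\<Sum>S\<in>[{1..l}]\<^bsup>2\<^esup>. lower_on K m S) + 3 = (\<Sum>S\<in>[{1..l}]\<^bsup>2\<^esup>. m S)"
proof -
  have K: "K \<subseteq> {1..l}" "finite K" "card K = 3" using assms(1) by (auto simp: nsets_def)
  have sub: "[K]\<^bsup>2\<^esup> \<subseteq> [{1..l}]\<^bsup>2\<^esup>" by (rule nsets_mono[OF K(1)])
  have split: "(\<Sum>S\<in>[{1..l}]\<^bsup>2\<^esup>. f S) = (\<Sum>S\<in>[{1..l}]\<^bsup>2\<^esup> - [K]\<^bsup>2\<^esup>. f S) + (\<Sum>S\<in>[K]\<^bsup>2\<^esup>. f S)" for f :: "nat set \<Rightarrow> nat"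
    by (rule sum.subset_diff[OF sub finite_pairs])
  have out: "(\<Sum>S\<in>[{1..l}]\<^bsup>2\<^esup> - [K]\<^bsup>2\<^esup>. lower_on K m S) = (\<Sum>S\<in>[{1..l}]\<^bsup>2\<^esup> - [K]\<^bsup>2\<^esup>. m S)"
    by (rule sum.cong) (auto simp: lower_on_def nsets_def)
  have "(\<Sum>S\<in>[K]\<^bsup>2\<^esup>. lower_on K m S) + card ([K]\<^bsup>2\<^esup>) = (\<Sum>S\<in>[K]\<^bsup>2\<^esup>. lower_on K m S + 1)"
    by (simp only: sum.distrib card_eq_sum)
  also have "\<dots> = (\<Sum>S\<in>[K]\<^bsup>2\<^esup>. m S)"
  proof (rule sum.cong[OF refl])
    fix S assume "S \<in> [K]\<^bsup>2\<^esup>"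
    then show "lower_on K m S + 1 = m S" using assms(2)[of S] by (simp add: lower_on_def nsets_def)
  qed
  finally have inn: "(\<Sum>S\<in>[K]\<^bsup>2\<^esup>. lower_on K m S) + card ([K]\<^bsup>2\<^esup>) = (\<Sum>S\<in>[K]\<^bsup>2\<^esup>. m S)" .
  have "card ([K]\<^bsup>2\<^esup>) = card K choose 2"
    unfolding nsets_def using n_subsets[OF K(2), of 2] by (metis (no_types, lifting) Collect_cong K(2) finite_subset)
  also have "\<dots> = 3" unfolding K(3) by (simp add: numeral_eq_Suc)
  finally show ?thesis using split[of m] split[of "lower_on K m"] out inn by linarith
qed

text \<open>The count of good tuples is squeezed between \<open>card_good_ge\<close> and
  \<open>card_good_le\<close>, with \<open>e\<close> and \<open>h\<close> supplied by
  \<open>s_star_ratio\<close> for \<open>t = 1\<close> and \<open>t = 3\<close>.\<close>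

lemma s_star_le_leading:
  assumes "l > 0"
  shows "\<exists>X\<ge>0. \<forall>\<^sub>F n in sequentially.
    (1 - X / sqrt n) * s_star n l m \<le> 2 ^ n * (leading_term l m n * (1 + X / sqrt n))"
proof -
  define M where "M = (\<Sum>S\<in>[{1..l}]\<^bsup>2\<^esup>. m S)"
  obtain D1 where D1: "D1 \<ge> 0" "\<forall>\<^sub>F n in sequentially. \<forall>m'. (\<Sum>S\<in>[{1..l}]\<^bsup>2\<^esup>. m' S) + 1 = M \<longrightarrow>
    real (s_star n l m') \<le> D1 / real n ^ 1 * s_star n l m"
    using s_star_ratio[OF assms, of 1 m] unfolding M_def by blast
  obtain D3 where D3: "D3 \<ge> 0" "\<forall>\<^sub>F n in sequentially. \<forall>m'. (\<Sum>S\<in>[{1..l}]\<^bsup>2\<^esup>. m' S) + 3 = M \<longrightarrow>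
    real (s_star n l m') \<le> D3 / real n ^ 3 * s_star n l m"
    using s_star_ratio[OF assms, of 3 m] unfolding M_def by blast
  define B where "B = 4 * real l ^ 2 * D1"
  \<comment> \<open>The loss in \<open>card_good_ge\<close>: \<open>n * sqrt (1 / n ^ 3)\<close> is
    \<open>1 / sqrt n\<close>, and \<open>d = B / n\<close> is even smaller in order.
    \<open>X2\<close> is the chord constant from \<open>power_one_add_le\<close>.\<close>
  define X1 where "X1 = real l * sqrt (2 * real l * D3) + real l ^ 2 * 2 ^ M * B"
  define X2 where "X2 = (1 + real M) ^ M"
  have B: "B \<ge> 0" using D1(1) by (simp add: B_def)
  have X1: "X1 \<ge> 0" using B D3(1) by (simp add: X1_def)
  have X2: "X2 \<ge> 0" by (simp add: X2_def)
  have "\<forall>\<^sub>F n in sequentially. real n > 2 ^ Suc M * B"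
    by (rule eventually_compose_filterlim[OF eventually_gt_at_top filterlim_real_sequentially])
  moreover have "\<forall>\<^sub>F n in sequentially. n > (0::nat)" by (rule eventually_gt_at_top)
  ultimately have "\<forall>\<^sub>F n in sequentially.
    (1 - (X1 + X2) / sqrt n) * s_star n l m \<le> 2 ^ n * (leading_term l m n * (1 + (X1 + X2) / sqrt n))"
    using D1(2) D3(2)
  proof eventually_elim
    case (elim n)
    have n: "real n \<ge> 1" using elim(2) by simp
    obtain F where F: "overlapping_on {1..n} l m F" "(\<Prod>k\<in>{1..l}. card (F k)) = s_star n l m"
      "\<And>k A B. k \<in> {1..l} \<Longrightarrow> A \<in> F k \<Longrightarrow> B \<subseteq> A \<Longrightarrow> B \<in> F k"
      using s_star_attained_by_downsets[of n l m] by blast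
    interpret extremal_tuple n l m F "D1 / n" "D3 / real n ^ 3"
    proof
      show "real (s_star n l (lower_on K m)) \<le> D1 / n * s_star n l m"
        if "K \<in> [{1..l}]\<^bsup>2\<^esup>" "m K > 0" for K
        using elim(3) sum_lower_on_pair[where m = m, OF that] unfolding M_def by simp
      show "real (s_star n l (lower_on K m)) \<le> D3 / real n ^ 3 * s_star n l m"
        if "K \<in> [{1..l}]\<^bsup>3\<^esup>" "\<And>S. S \<in> [K]\<^bsup>2\<^esup> \<Longrightarrow> m S > 0" for K
        using elim(4) sum_lower_on_triple[where m = m, OF that] unfolding M_def by blast
      show "B \<in> F k" if "k \<in> {1..l}" "A \<in> F k" "B \<subseteq> A" for k A B
        using that by (rule F(3))
      show "0 \<le> D1 / n" "0 \<le> D3 / real n ^ 3" using D1(1) D3(1) by simp_all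
    qed (fact assms F(1) F(2))+
    have dB: "d = B / n" by (simp add: d_def B_def)
    have sq: "1 / real n \<le> 1 / sqrt n"
      using n by (intro divide_left_mono) (auto simp: real_le_lsqrt power2_eq_square)
    have x1: "real l * real n * sqrt (2 * real l * (D3 / real n ^ 3)) + real l ^ 2 * 2 ^ M * d \<le> X1 / sqrt n"
    proof -
      have "real n ^ 3 = real n ^ 2 * real n" by (simp add: numeral_eq_Suc)
      then have "sqrt (real n ^ 3) = real n * sqrt n" by (simp add: real_sqrt_mult)
      then have "real n * sqrt (2 * real l * (D3 / real n ^ 3)) = sqrt (2 * real l * D3) / sqrt n"
        using n by (simp add: real_sqrt_divide real_sqrt_mult)
      then have "real l * real n * sqrt (2 * real l * (D3 / real n ^ 3)) = real l * sqrt (2 * real l * D3) * (1 / sqrt n)"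
        by (simp add: mult.assoc)
      moreover have "real l ^ 2 * 2 ^ M * d \<le> real l ^ 2 * 2 ^ M * B * (1 / sqrt n)"
        using mult_left_mono[OF sq, of "real l ^ 2 * 2 ^ M * B"] B by (simp add: dB)
      ultimately show ?thesis by (simp add: X1_def add_divide_distrib)
    qed
    have "(1 - (X1 + X2) / sqrt n) * s_star n l m \<le> (1 - X1 / sqrt n) * s_star n l m"
      using X2 n by (intro mult_right_mono) (auto simp: divide_right_mono)
    also have "\<dots> \<le> (1 - (real l * real n * sqrt (2 * real l * (D3 / real n ^ 3)) + real l ^ 2 * 2 ^ M * d)) * s_star n l m"
      using x1 by (intro mult_right_mono) auto
    also have "\<dots> \<le> card good"
    proof (rule card_good_ge)
      show "m S \<le> M" if "S \<in> [{1..l}]\<^bsup>2\<^esup>" for S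
        unfolding M_def by (rule member_le_sum[OF that _ finite_pairs]) simp
      show "2 ^ Suc M * d < 1" using elim(1) n by (simp add: dB)
    qed
    also have "real (card good) \<le> 2 ^ n * (\<Prod>S\<in>[{1..l}]\<^bsup>2\<^esup>. real (card {W. W \<subseteq> stall S \<and> card W \<le> m S}))"
      using of_nat_mono[OF card_good_le, where 'a = real] by simp
    also have "\<dots> \<le> 2 ^ n * (leading_term l m n * (1 + real M / n) ^ M)"
      unfolding M_def using elim(2) sum_card_stall
      by (intro mult_left_mono prod_small_subsets_le_leading) (auto simp: stall_def)
    also have "\<dots> \<le> 2 ^ n * (leading_term l m n * (1 + (X1 + X2) / sqrt n))"
    proof (intro mult_left_mono)
      have "(1 + real M * (1 / n)) ^ M \<le> 1 + (X2 - 1) * (1 / n)"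
        unfolding X2_def by (rule power_one_add_le) (use n in auto)
      also have "(X2 - 1) * (1 / n) \<le> X2 * (1 / sqrt n)"
        using X2 sq by (intro mult_mono) auto
      also have "\<dots> \<le> (X1 + X2) / sqrt n" using X1 n by (simp add: divide_right_mono)
      finally show "(1 + real M / n) ^ M \<le> 1 + (X1 + X2) / sqrt n" by simp
      show "0 \<le> leading_term l m n" using leading_term_pos[of n l m] n by simp
    qed simp
    finally show ?case .
  qed
  then show ?thesis using X1 X2 by (intro exI[of _ "X1 + X2"]) auto
qed

theorem theorem2:
  fixes l :: nat and m :: "nat set \<Rightarrow> nat"
  assumes "l > 0"
  shows "\<exists>\<epsilon> :: nat \<Rightarrow> real. \<epsilon> \<in> O(\<lambda>n. 1 / sqrt (real n)) \<and>
    (\<forall>\<^sub>F n in sequentially.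
       real (s_star n l m) =
         (1 + \<epsilon> n) * 2 ^ n *
         (\<Prod>S\<in>[{1..l}]\<^bsup>2\<^esup>.
            1 / fact (m S) *
            (real (m S) * real n / (\<Sum>S'\<in>[{1..l}]\<^bsup>2\<^esup>. real (m S'))) ^ m S))"
proof -
  obtain X where X: "X \<ge> 0" "\<forall>\<^sub>F n in sequentially.
    (1 - X / sqrt n) * s_star n l m \<le> 2 ^ n * (leading_term l m n * (1 + X / sqrt n))"
    using s_star_le_leading[OF assms] by blast
  define M where "M = (\<Sum>S\<in>[{1..l}]\<^bsup>2\<^esup>. real (m S))"
  define T where "T = (\<lambda>n::nat. 2 ^ n * leading_term l m n)"
  \<comment> \<open>The exact relative error, so that the required equation is an identity for
    \<open>n > 0\<close> and only its size is at issue.\<close>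
  define \<epsilon> where "\<epsilon> = (\<lambda>n. s_star n l m / T n - 1)"
  have T: "T n > 0" if "n > 0" for n using leading_term_pos[of n l m] that by (simp add: T_def)
  \<comment> \<open>This threshold gives \<open>X / sqrt n < 1/2\<close>, which keeps
    \<open>1 - X / sqrt n\<close> away from 0.\<close>
  have "\<forall>\<^sub>F n in sequentially. real n > (2 * X) ^ 2"
    by (rule eventually_compose_filterlim[OF eventually_gt_at_top filterlim_real_sequentially])
  moreover have "\<forall>\<^sub>F n in sequentially. n > (0::nat)" by (rule eventually_gt_at_top)
  ultimately have "\<forall>\<^sub>F n in sequentially. norm (\<epsilon> n) \<le> (4 * X + M ^ 2) * norm (1 / sqrt (real n))"
    using X(2)
  proof eventually_elim
    case (elim n)
    define y where "y = 1 / sqrt (real n)"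
    have n: "real n \<ge> 1" using elim(2) by simp
    have y: "y > 0" "1 / real n \<le> y"
      using n by (auto simp: y_def intro!: divide_left_mono simp: real_le_lsqrt power2_eq_square)
    have "2 * X < sqrt n" using elim(1) X(1) by (intro real_less_rsqrt)
    then have Xy: "X * y < 1/2" using n by (simp add: y_def field_simps)
    have "(1 - X * y) * s_star n l m \<le> T n * (1 + X * y)"
      using elim(3) by (simp add: T_def y_def mult.assoc)
    then have "(1 - X * y) * (s_star n l m / T n) \<le> 1 + X * y"
      using T[OF elim(2)] by (simp add: field_simps)
    \<comment> \<open>For \<open>0 \<le> u \<le> 1/2\<close> one has
      \<open>1 + u \<le> (1 - u) * (1 + 4 * u)\<close>, so the factor \<open>1 - X * y\<close> can
      be cancelled.\<close>
    also have "\<dots> \<le> (1 - X * y) * (1 + 4 * (X * y))"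
    proof -
      have "(X * y) * (4 * (X * y)) \<le> (1/2) * (4 * (X * y))"
        using Xy X(1) y(1) by (intro mult_right_mono) auto
      then show ?thesis by (simp add: algebra_simps)
    qed
    finally have "s_star n l m / T n \<le> 1 + 4 * (X * y)"
      by (rule mult_left_le_imp_le) (use Xy in simp)
    then have up: "\<epsilon> n \<le> 4 * (X * y)" by (simp add: \<epsilon>_def)
    have "T n * (1 - M ^ 2 / n) \<le> s_star n l m"
      using s_star_ge_leading[OF assms elim(2), of m] unfolding T_def M_def .
    then have "1 - M ^ 2 * (1 / n) \<le> s_star n l m / T n"
      using T[OF elim(2)] by (simp add: pos_le_divide_eq mult.commute)
    then have "- (M ^ 2 * (1 / n)) \<le> \<epsilon> n" by (simp add: \<epsilon>_def)
    moreover have "M ^ 2 * (1 / n) \<le> M ^ 2 * y" using y(2) by (rule mult_left_mono) simp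
    moreover have "0 \<le> M ^ 2 * y" "0 \<le> X * y" using y(1) X(1) by auto
    ultimately have "\<bar>\<epsilon> n\<bar> \<le> 4 * (X * y) + M ^ 2 * y" using up by linarith
    also have "\<dots> = (4 * X + M ^ 2) * norm y" using y(1) by (simp add: algebra_simps)
    finally show ?case by (simp add: y_def)
  qed
  then have "\<epsilon> \<in> O(\<lambda>n. 1 / sqrt (real n))" by (rule bigoI)
  moreover have "\<forall>\<^sub>F n in sequentially. real (s_star n l m) = (1 + \<epsilon> n) * 2 ^ n *
         (\<Prod>S\<in>[{1..l}]\<^bsup>2\<^esup>.
            1 / fact (m S) *
            (real (m S) * real n / (\<Sum>S'\<in>[{1..l}]\<^bsup>2\<^esup>. real (m S'))) ^ m S)"
    using eventually_gt_at_top[of "0::nat"]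
  proof eventually_elim
    case (elim n)
    have "real (s_star n l m) = (1 + \<epsilon> n) * T n" using T[OF elim] by (simp add: \<epsilon>_def)
    then show ?case by (simp only: T_def leading_term_def mult.assoc)
  qed
  ultimately show ?thesis by blast
qed

end
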